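(* Let $G$ be a Lie group with Lie algebra $\mathfrak g$, and let $L=L(\xi_2,\xi_3)$ be a smooth function on the Lie algebra $\mathfrak g\circledS\mathfrak g$ of the group $G\circledS\mathfrak g$. The Euler–Poincaré equations on $\mathfrak g\circledS\mathfrak g$ for $L$ (that is, the equations characterizing the curves $(\xi_2(t),\xi_3(t))$ that are extremal for $\int_a^b L\,dt$ under the variations $\delta(\xi_2,\xi_3)=\frac{d}{dt}(\eta_2,\eta_3)+[(\xi_2,\xi_3),(\eta_2,\eta_3)]_{\mathfrak g\circledS\mathfrak g}$ with $(\eta_2,\eta_3)$ arbitrary and vanishing at the end points) are $$\frac{d}{dt}\frac{\delta L}{\delta\xi_2}=ad^*_{\xi_2}\frac{\delta L}{\delta\xi_2}+ad^*_{\xi_3}\frac{\delta L}{\delta\xi_3},\qquad \frac{d}{dt}\frac{\delta L}{\delta\xi_3}=ad^*_{\xi_2}\frac{\delta L}{\delta\xi_3}.$$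
   Context: Conventions. $G$ is a (finite-dimensional) Lie group, $\mathfrak g=T_eG$, $\mathfrak g^*$ its dual. $Ad_g$ is the tangent map at $e$ of $h\mapsto g^{-1}hg$. The Lie bracket on $\mathfrak g$ is $[\xi,\eta]=ad_\xi\eta=\frac{d}{dt}|_{t=0}Ad_{\exp(t\xi)}\eta$ (the bracket of right invariant vector fields). $ad^*_\xi$ is defined by $\langle ad^*_\xi\mu,\eta\rangle=\langle\mu,[\xi,\eta]\rangle$. $\delta L/\delta\xi_i\in\mathfrak g^*$ are partial derivatives. $G\circledS\mathfrak g$ is $G\times\mathfrak g$ with multiplication $(g,\xi)(h,\eta)=(gh,\xi+Ad_{g^{-1}}\eta)$; its Lie algebra $\mathfrak g\circledS\mathfrak g$ has bracket $$[(\xi_2,\xi_3),(\eta_2,\eta_3)]_{\mathfrak g\circledS\mathfrak g}=([\xi_2,\eta_2],\,[\xi_2,\eta_3]-[\eta_2,\xi_3]).$$ *)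

theory Defs
  imports "HOL-Analysis.Analysis" "HOL-Algebra.Group"
begin

section \<open>Smooth maps\<close>

text \<open>
  \<open>C\<^sup>k\<close> and smooth maps on an open set. Derivatives are taken at points of the whole space, so these
  notions are only meant for open \<open>S\<close>. In finite dimension, asking that every directional
  derivative is \<open>C\<^sup>k\<close> is the same as asking that the derivative is \<open>C\<^sup>k\<close>.
\<close>

primrec C_k_on :: "nat \<Rightarrow> 'a::real_normed_vector set \<Rightarrow> ('a \<Rightarrow> 'b::real_normed_vector) \<Rightarrow> bool" where
  "C_k_on 0 S f \<longleftrightarrow> continuous_on S f"
| "C_k_on (Suc k) S f \<longleftrightarrow>
     (\<forall>x\<in>S. f differentiable (at x)) \<and> (\<forall>v. C_k_on k S (\<lambda>x. frechet_derivative f (at x) v))"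

definition smooth_on :: "'a::real_normed_vector set \<Rightarrow> ('a \<Rightarrow> 'b::real_normed_vector) \<Rightarrow> bool" where
  "smooth_on S f \<longleftrightarrow> (\<forall>k. C_k_on k S f)"

text \<open>Curves on a compact interval are smooth up to the end points: they extend smoothly
  to a neighbourhood of the interval.\<close>

definition smooth_curve :: "real \<Rightarrow> real \<Rightarrow> (real \<Rightarrow> 'a::real_normed_vector) \<Rightarrow> bool" where
  "smooth_curve a b x \<longleftrightarrow> (\<exists>S. open S \<and> {a..b} \<subseteq> S \<and> smooth_on S x)"


section \<open>Lie groups\<close>

text \<open>A chart is a pair of its domain and its coordinate map.\<close>

type_synonym ('m, 'e) chart = "'m set \<times> ('m \<Rightarrow> 'e)"

definition is_chart :: "('m::topological_space, 'e::euclidean_space) chart \<Rightarrow> bool" where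
  "is_chart c \<longleftrightarrow> (case c of (U, \<phi>) \<Rightarrow>
     open U \<and> open (\<phi> ` U) \<and> homeomorphism U (\<phi> ` U) \<phi> (inv_into U \<phi>))"

definition smooth_atlas :: "('m::topological_space, 'e::euclidean_space) chart set \<Rightarrow> bool" where
  "smooth_atlas A \<longleftrightarrow>
     (\<forall>c\<in>A. is_chart c) \<and> (\<Union>c\<in>A. fst c) = UNIV \<and>
     (\<forall>(U, \<phi>)\<in>A. \<forall>(V, \<psi>)\<in>A. smooth_on (\<phi> ` (U \<inter> V)) (\<psi> \<circ> inv_into U \<phi>))"

definition smooth_map ::
  "('m::topological_space, 'e::euclidean_space) chart set \<Rightarrow>
   ('n::topological_space, 'f::euclidean_space) chart set \<Rightarrow> ('m \<Rightarrow> 'n) \<Rightarrow> bool" where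
  "smooth_map A B f \<longleftrightarrow>
     continuous_on UNIV f \<and>
     (\<forall>(U, \<phi>)\<in>A. \<forall>(V, \<psi>)\<in>B. smooth_on (\<phi> ` (U \<inter> f -` V)) (\<psi> \<circ> f \<circ> inv_into U \<phi>))"

definition prod_atlas ::
  "('m, 'e) chart set \<Rightarrow> ('n, 'f) chart set \<Rightarrow> ('m \<times> 'n, 'e \<times> 'f) chart set" where
  "prod_atlas A B = {(U \<times> V, map_prod \<phi> \<psi>) | U \<phi> V \<psi>. (U, \<phi>) \<in> A \<and> (V, \<psi>) \<in> B}"

text \<open>The underlying manifold is the whole type \<open>'m\<close>, the Hausdorff and second countability
  axioms being part of its sort.\<close>

definition lie_group ::
  "'m::{t2_space, second_countable_topology} monoid \<Rightarrow> ('m, 'g::euclidean_space) chart set \<Rightarrow> bool" where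
  "lie_group G A \<longleftrightarrow>
     group G \<and> carrier G = UNIV \<and> smooth_atlas A \<and>
     smooth_map (prod_atlas A A) A (\<lambda>(g, h). g \<otimes>\<^bsub>G\<^esub> h) \<and>
     smooth_map A A (\<lambda>g. inv\<^bsub>G\<^esub> g)"


section \<open>The Lie algebra of a Lie group\<close>

text \<open>
  A chart \<open>c\<close> of \<open>G\<close> at the identity identifies the tangent space \<open>T\<^sub>e G\<close> with the model space \<open>'g\<close>.
  Tangent vectors at the identity and tangent maps there are written in this identification.
  The operator \<open>lie_Ad G c g\<close> is the tangent map at \<open>e\<close> of \<open>h \<mapsto> g\<^sup>-\<^sup>1 h g\<close>; note the side of the inverse.
\<close>

definition lie_Ad ::
  "'m monoid \<Rightarrow> ('m, 'g::euclidean_space) chart \<Rightarrow> 'm \<Rightarrow> 'g \<Rightarrow> 'g" where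
  "lie_Ad G c g = (case c of (U, \<phi>) \<Rightarrow>
     frechet_derivative (\<lambda>x. \<phi> (inv\<^bsub>G\<^esub> g \<otimes>\<^bsub>G\<^esub> inv_into U \<phi> x \<otimes>\<^bsub>G\<^esub> g)) (at (\<phi> \<one>\<^bsub>G\<^esub>)))"

definition one_parameter_subgroup :: "'m::topological_space monoid \<Rightarrow> (real \<Rightarrow> 'm) \<Rightarrow> bool" where
  "one_parameter_subgroup G \<gamma> \<longleftrightarrow>
     continuous_on UNIV \<gamma> \<and> (\<forall>s t. \<gamma> (s + t) = \<gamma> s \<otimes>\<^bsub>G\<^esub> \<gamma> t)"

definition lie_exp ::
  "'m::topological_space monoid \<Rightarrow> ('m, 'g::euclidean_space) chart \<Rightarrow> 'g \<Rightarrow> 'm" where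
  "lie_exp G c \<xi> = (THE \<gamma>. one_parameter_subgroup G \<gamma> \<and>
                          ((snd c \<circ> \<gamma>) has_vector_derivative \<xi>) (at 0)) 1"

definition lie_bracket ::
  "'m::topological_space monoid \<Rightarrow> ('m, 'g::euclidean_space) chart \<Rightarrow> 'g \<Rightarrow> 'g \<Rightarrow> 'g" where
  "lie_bracket G c \<xi> \<eta> = vector_derivative (\<lambda>t. lie_Ad G c (lie_exp G c (t *\<^sub>R \<xi>)) \<eta>) (at 0)"

text \<open>The dual of \<open>'g\<close> is the type \<open>'g \<Rightarrow>\<^sub>L real\<close>.\<close>

definition ad_star :: "('g::euclidean_space \<Rightarrow> 'g \<Rightarrow> 'g) \<Rightarrow> 'g \<Rightarrow> ('g \<Rightarrow>\<^sub>L real) \<Rightarrow> ('g \<Rightarrow>\<^sub>L real)" where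
  "ad_star br \<xi> \<mu> = Blinfun (\<lambda>\<eta>. blinfun_apply \<mu> (br \<xi> \<eta>))"

text \<open>The bracket of the Lie algebra of the semidirect product group \<open>G \<times> \<gg>\<close> with multiplication
  \<open>(g, \<xi>) (h, \<eta>) = (g h, \<xi> + Ad (g\<^sup>-\<^sup>1) \<eta>)\<close>, where \<open>br\<close> is the bracket of \<open>\<gg>\<close>.\<close>

definition semidirect_bracket ::
  "('g::euclidean_space \<Rightarrow> 'g \<Rightarrow> 'g) \<Rightarrow> 'g \<times> 'g \<Rightarrow> 'g \<times> 'g \<Rightarrow> 'g \<times> 'g" where
  "semidirect_bracket br = (\<lambda>(\<xi>2, \<xi>3) (\<eta>2, \<eta>3). (br \<xi>2 \<eta>2, br \<xi>2 \<eta>3 - br \<eta>2 \<xi>3))"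


section \<open>Extremals under constrained variations\<close>

text \<open>
  For a bracket \<open>br\<close> on \<open>'h\<close>, \<open>X\<close> is a smooth family of curves deforming \<open>x\<close> on \<open>[a, b]\<close>
  with infinitesimal variation \<open>\<delta>x = d\<eta>/dt + [x, \<eta>]\<close>.
\<close>

definition constrained_deformation ::
  "('h::euclidean_space \<Rightarrow> 'h \<Rightarrow> 'h) \<Rightarrow> real \<Rightarrow> real \<Rightarrow> (real \<Rightarrow> 'h) \<Rightarrow> (real \<Rightarrow> 'h) \<Rightarrow>
   (real \<Rightarrow> real \<Rightarrow> 'h) \<Rightarrow> bool" where
  "constrained_deformation br a b x \<eta> X \<longleftrightarrow>
     (\<exists>S. open S \<and> {0} \<times> {a..b} \<subseteq> S \<and> smooth_on S (\<lambda>(\<epsilon>, t). X \<epsilon> t)) \<and>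
     (\<forall>t\<in>{a..b}. X 0 t = x t) \<and>
     (\<forall>t\<in>{a..b}. ((\<lambda>\<epsilon>. X \<epsilon> t) has_vector_derivative
                   (vector_derivative \<eta> (at t) + br (x t) (\<eta> t))) (at 0))"

definition euler_poincare_extremal ::
  "('h::euclidean_space \<Rightarrow> 'h \<Rightarrow> 'h) \<Rightarrow> ('h \<Rightarrow> real) \<Rightarrow> real \<Rightarrow> real \<Rightarrow> (real \<Rightarrow> 'h) \<Rightarrow> bool" where
  "euler_poincare_extremal br L a b x \<longleftrightarrow>
     (\<forall>\<eta> X. smooth_curve a b \<eta> \<and> \<eta> a = 0 \<and> \<eta> b = 0 \<and> constrained_deformation br a b x \<eta> X \<longrightarrow>
        ((\<lambda>\<epsilon>. integral {a..b} (\<lambda>t. L (X \<epsilon> t))) has_real_derivative 0) (at 0))"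

definition partial_fst :: "('g::euclidean_space \<times> 'g \<Rightarrow> real) \<Rightarrow> 'g \<times> 'g \<Rightarrow> ('g \<Rightarrow>\<^sub>L real)" where
  "partial_fst L = (\<lambda>(\<xi>2, \<xi>3). Blinfun (frechet_derivative (\<lambda>\<xi>. L (\<xi>, \<xi>3)) (at \<xi>2)))"

definition partial_snd :: "('g::euclidean_space \<times> 'g \<Rightarrow> real) \<Rightarrow> 'g \<times> 'g \<Rightarrow> ('g \<Rightarrow>\<^sub>L real)" where
  "partial_snd L = (\<lambda>(\<xi>2, \<xi>3). Blinfun (frechet_derivative (\<lambda>\<xi>. L (\<xi>2, \<xi>)) (at \<xi>3)))"

end

theory Submission
  imports Defs
begin

text \<open>
  For a bilinear bracket, the first variation of the action along an admissible deformation is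
  \<open>\<integral> DL(x) (\<eta>' + [x, \<eta>]) dt\<close>; integrating by parts and testing with \<open>\<eta> = (t - a) (b - t) R\<close>, where
  \<open>R\<close> represents the residual \<open>d/dt DL(x) - DL(x) [x, -]\<close>, gives the Euler-Poincare equation
  \<open>d/dt DL(x) = DL(x) [x, -]\<close>. For the semidirect bracket this splits into the two equations as soon
  as the bracket of \<open>\<gg>\<close> is antisymmetric.

  That the bracket of a Lie group is bilinear and alternating is read off in a chart at the identity.
  One-parameter subgroups exist and are unique because they are the integral curves through the
  identity of left invariant vector fields. Hence \<open>[\<xi>, \<eta>]\<close> is the derivative in direction \<open>\<xi>\<close> of the
  smooth function \<open>u \<mapsto> Ad\<^sub>u \<eta>\<close>; so it is linear in \<open>\<xi>\<close> and, since \<open>Ad\<^sub>u\<close> is linear, in \<open>\<eta>\<close>. It vanishes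
  for \<open>\<eta> = \<xi>\<close> because a one-parameter subgroup is commutative, so that \<open>Ad\<close> fixes its generator.
\<close>

section \<open>Calculus of smooth maps\<close>

lemma C_k_on_subset: "C_k_on k S f \<Longrightarrow> T \<subseteq> S \<Longrightarrow> C_k_on k T f"
  by (induction k arbitrary: f) (auto intro: continuous_on_subset)

lemma C_k_on_cong:
  assumes "open S" "C_k_on k S f" "\<And>x. x \<in> S \<Longrightarrow> f x = g x"
  shows "C_k_on k S g"
  using assms(2,3)
proof (induction k arbitrary: f g)
  case 0
  then show ?case using continuous_on_cong[of S S f g] by simp
next
  case (Suc k)
  have g: "(g has_derivative frechet_derivative f (at x)) (at x)" if "x \<in> S" for x
  proof (rule has_derivative_transform_within_open[OF _ assms(1) that])
    show "(f has_derivative frechet_derivative f (at x)) (at x)"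
      using Suc.prems that by (auto simp: frechet_derivative_works)
  qed (use Suc.prems in auto)
  have "C_k_on k S (\<lambda>x. frechet_derivative g (at x) v)" for v
    by (rule Suc.IH[of "\<lambda>x. frechet_derivative f (at x) v"])
       (use Suc.prems frechet_derivative_at[OF g] in auto)
  then show ?case using g by (auto simp: differentiable_def)
qed

text \<open>Lets an induction name the derivative explicitly; uniqueness of derivatives identifies
  it with \<open>frechet_derivative\<close> at every point of \<open>S\<close>.\<close>

lemma C_k_on_SucI:
  assumes "open S" "\<And>x. x \<in> S \<Longrightarrow> (f has_derivative f' x) (at x)" "\<And>v. C_k_on k S (\<lambda>x. f' x v)"
  shows "C_k_on (Suc k) S f"
proof -
  have "C_k_on k S (\<lambda>x. frechet_derivative f (at x) v)" for v
    by (rule C_k_on_cong[OF assms(1) assms(3)[of v]]) (simp flip: frechet_derivative_at[OF assms(2)])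
  then show ?thesis using assms(2) by (auto simp: differentiable_def)
qed

lemma C_k_on_SucD:
  assumes "C_k_on (Suc k) S f"
  shows "x \<in> S \<Longrightarrow> (f has_derivative frechet_derivative f (at x)) (at x)"
    and "C_k_on k S (\<lambda>x. frechet_derivative f (at x) v)"
  using assms by (auto simp: frechet_derivative_works)

lemma C_k_on_pred: "C_k_on (Suc k) S f \<Longrightarrow> C_k_on k S f"
proof (induction k arbitrary: f)
  case 0
  then show ?case
    by (auto intro!: differentiable_imp_continuous_on differentiable_at_imp_differentiable_on)
next
  case (Suc k)
  then show ?case by (metis C_k_on.simps(2))
qed

lemma C_k_on_const: "C_k_on k S (\<lambda>x. c)"
  by (induction k arbitrary: c) auto

lemma C_k_on_add:
  assumes "open S" "C_k_on k S f" "C_k_on k S g"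
  shows "C_k_on k S (\<lambda>x. f x + g x)"
  using assms(2,3)
proof (induction k arbitrary: f g)
  case 0
  then show ?case by (auto intro: continuous_on_add)
next
  case (Suc k)
  note D = C_k_on_SucD[OF Suc.prems(1)] C_k_on_SucD[OF Suc.prems(2)]
  show ?case
    by (rule C_k_on_SucI[OF assms(1)]) (auto intro!: has_derivative_add Suc.IH D)
qed

lemma C_k_on_sum:
  assumes "open S" "\<And>i. i \<in> I \<Longrightarrow> C_k_on k S (f i)"
  shows "C_k_on k S (\<lambda>x. \<Sum>i\<in>I. f i x)"
  using assms(2)
  by (induction I rule: infinite_finite_induct)
     (auto intro!: C_k_on_const C_k_on_add[OF assms(1)])

lemma C_k_on_bounded_linear:
  assumes "open S" "bounded_linear h" "C_k_on k S f"
  shows "C_k_on k S (\<lambda>x. h (f x))"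
  using assms(3)
proof (induction k arbitrary: f)
  case 0
  then show ?case by (auto intro: bounded_linear.continuous_on[OF assms(2)])
next
  case (Suc k)
  note D = C_k_on_SucD[OF Suc.prems(1)]
  show ?case
    by (rule C_k_on_SucI[OF assms(1)])
       (auto intro!: bounded_linear.has_derivative[OF assms(2)] Suc.IH D)
qed

lemma C_k_on_id: "open S \<Longrightarrow> C_k_on k S (\<lambda>x. x)"
  by (cases k) (auto intro!: C_k_on_SucI C_k_on_const)

lemma C_k_on_bounded_bilinear:
  assumes "open S" "bounded_bilinear h" "C_k_on k S f" "C_k_on k S g"
  shows "C_k_on k S (\<lambda>x. h (f x) (g x))"
  using assms(3,4)
proof (induction k arbitrary: f g)
  case 0
  then show ?case by (auto intro: bounded_bilinear.continuous_on[OF assms(2)])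
next
  case (Suc k)
  note D = C_k_on_SucD[OF Suc.prems(1)] C_k_on_SucD[OF Suc.prems(2)]
  show ?case
    by (rule C_k_on_SucI[OF assms(1)])
       (auto intro!: bounded_bilinear.FDERIV[OF assms(2)] Suc.IH C_k_on_add assms(1) D
        C_k_on_pred[OF Suc.prems(1)] C_k_on_pred[OF Suc.prems(2)])
qed

text \<open>\<open>C_k_on\<close> controls derivatives only in fixed directions. When the direction
  moves with the point, this expansion leaves finitely many fixed directions with scalar
  coefficients.\<close>

lemma linear_basis_expansion:
  fixes w :: "'a::euclidean_space"
  assumes "linear f"
  shows "f w = (\<Sum>b\<in>Basis. (w \<bullet> b) *\<^sub>R f b)"
  by (metis (no_types, lifting) assms euclidean_representation linear_scale linear_sum sum.cong)

lemma C_k_on_compose: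
  fixes f :: "'a::real_normed_vector \<Rightarrow> 'b::euclidean_space"
  assumes S: "open S" and T: "open T" "f ` S \<subseteq> T" and "C_k_on k S f" "C_k_on k T g"
  shows "C_k_on k S (\<lambda>x. g (f x))"
  using assms(3-)
proof (induction k arbitrary: f g)
  case 0
  then show ?case by (auto intro: continuous_on_compose2)
next
  case (Suc k)
  note Df = C_k_on_SucD[OF Suc.prems(2)] and Dg = C_k_on_SucD[OF Suc.prems(3)]
  \<comment> \<open>The chain rule with the moving direction
    \<open>frechet_derivative f (at x) v\<close> expanded in the basis. Each summand is a product of
    a component of the derivative of \<open>f\<close> and a fixed-direction derivative of
    \<open>g\<close> composed with \<open>f\<close>, so the induction hypothesis applies.\<close>
  let ?D = "\<lambda>x v. \<Sum>b\<in>Basis. (frechet_derivative f (at x) v \<bullet> b) *\<^sub>R frechet_derivative g (at (f x)) b"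
  have "((\<lambda>x. g (f x)) has_derivative ?D x) (at x)" if "x \<in> S" for x
  proof -
    have "f x \<in> T" using Suc.prems(1) that by auto
    note d = Dg(1)[OF this]
    show ?thesis
      using has_derivative_compose[OF Df(1)[OF that] d]
      by (subst (asm) linear_basis_expansion[OF has_derivative_linear[OF d]])
  qed
  moreover have "C_k_on k S (\<lambda>x. ?D x v)" for v
    by (intro C_k_on_sum C_k_on_bounded_bilinear[OF _ bounded_bilinear_scaleR]
        C_k_on_bounded_linear[OF _ bounded_linear_inner_left] Suc.IH S Suc.prems(1) Df(2) Dg(2)
        C_k_on_pred[OF Suc.prems(2)])
  ultimately show ?case by (rule C_k_on_SucI[OF S])
qed

lemma smooth_onD:
  assumes "smooth_on S f"
  shows "x \<in> S \<Longrightarrow> (f has_derivative frechet_derivative f (at x)) (at x)"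
    and "smooth_on S (\<lambda>x. frechet_derivative f (at x) v)"
    and "continuous_on S f"
proof -
  have *: "C_k_on k S f" for k using assms by (simp add: smooth_on_def)
  show "x \<in> S \<Longrightarrow> (f has_derivative frechet_derivative f (at x)) (at x)"
    by (rule C_k_on_SucD(1)[OF *])
  show "smooth_on S (\<lambda>x. frechet_derivative f (at x) v)"
    unfolding smooth_on_def using C_k_on_SucD(2)[OF *] by blast
  show "continuous_on S f" using *[of 0] by simp
qed

lemma smooth_on_subset: "smooth_on S f \<Longrightarrow> T \<subseteq> S \<Longrightarrow> smooth_on T f"
  unfolding smooth_on_def using C_k_on_subset by blast

lemma smooth_on_cong:
  "open S \<Longrightarrow> smooth_on S f \<Longrightarrow> (\<And>x. x \<in> S \<Longrightarrow> f x = g x) \<Longrightarrow> smooth_on S g"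
  unfolding smooth_on_def using C_k_on_cong by blast

lemma smooth_on_const: "smooth_on S (\<lambda>x. c)"
  and smooth_on_id: "open S \<Longrightarrow> smooth_on S (\<lambda>x. x)"
  and smooth_on_add: "open S \<Longrightarrow> smooth_on S f \<Longrightarrow> smooth_on S g \<Longrightarrow> smooth_on S (\<lambda>x. f x + g x)"
  and smooth_on_sum:
    "open S \<Longrightarrow> (\<And>i. i \<in> I \<Longrightarrow> smooth_on S (F i)) \<Longrightarrow> smooth_on S (\<lambda>x. \<Sum>i\<in>I. F i x)"
  and smooth_on_bounded_linear:
    "open S \<Longrightarrow> bounded_linear h \<Longrightarrow> smooth_on S f \<Longrightarrow> smooth_on S (\<lambda>x. h (f x))"
  and smooth_on_bounded_bilinear:
    "open S \<Longrightarrow> bounded_bilinear B \<Longrightarrow> smooth_on S p \<Longrightarrow> smooth_on S q \<Longrightarrow>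
      smooth_on S (\<lambda>x. B (p x) (q x))"
  unfolding smooth_on_def
  by (blast intro: C_k_on_const C_k_on_id C_k_on_add C_k_on_sum C_k_on_bounded_linear
      C_k_on_bounded_bilinear)+

lemma smooth_on_compose:
  fixes f :: "'a::real_normed_vector \<Rightarrow> 'b::euclidean_space"
  shows "open S \<Longrightarrow> open T \<Longrightarrow> f ` S \<subseteq> T \<Longrightarrow> smooth_on S f \<Longrightarrow> smooth_on T g \<Longrightarrow>
    smooth_on S (\<lambda>x. g (f x))"
  unfolding smooth_on_def using C_k_on_compose by blast

lemma smooth_on_Pair:
  assumes "open S" "smooth_on S f" "smooth_on S g"
  shows "smooth_on S (\<lambda>x. (f x, g x))"
proof -
  have "smooth_on S (\<lambda>x. (f x, 0) + (0, g x))"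
    by (intro smooth_on_add assms smooth_on_bounded_linear[of _ "\<lambda>y. (y, 0)"]
        smooth_on_bounded_linear[of _ "\<lambda>y. (0, y)"] bounded_linear_Pair bounded_linear_zero
        bounded_linear_ident)
  then show ?thesis by simp
qed

section \<open>Extremals and the first variation\<close>

text \<open>Differentiation under the integral sign, followed by the chain rule at parameter 0,
  where the velocity of \<open>X\<close> is prescribed.\<close>

lemma first_variation:
  fixes br :: "'h::euclidean_space \<Rightarrow> 'h \<Rightarrow> 'h" and L :: "'h \<Rightarrow> real"
  assumes L: "smooth_on UNIV L" and X: "constrained_deformation br a b x \<eta> X"
  shows "((\<lambda>\<epsilon>. integral {a..b} (\<lambda>t. L (X \<epsilon> t))) has_real_derivative
      integral {a..b} (\<lambda>t. frechet_derivative L (at (x t)) (vector_derivative \<eta> (at t) + br (x t) (\<eta> t))))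
      (at 0)"
proof -
  obtain S where S: "open S" "{0} \<times> {a..b} \<subseteq> S" "smooth_on S (\<lambda>(\<epsilon>, t). X \<epsilon> t)"
    using X unfolding constrained_deformation_def by blast
  \<comment> \<open>Compactness of \<open>{a..b}\<close> gives one range of parameters that serves
    all times, as the Leibniz rule requires.\<close>
  obtain U where U: "0 \<in> U" "open U" "U \<times> {a..b} \<subseteq> S"
    using Elementary_Topology.tube_lemma[OF compact_Icc S(1), of 0 a b] S(2) by auto
  then obtain d where d: "d > 0" "ball 0 d \<subseteq> U" by (auto simp: open_contains_ball)
  define F where "F = (\<lambda>p. L (case p of (\<epsilon>, t) \<Rightarrow> X \<epsilon> t))"
  have F: "smooth_on S F"
    unfolding F_def by (rule smooth_on_compose[OF S(1) open_UNIV _ S(3) L]) auto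
  note dF = smooth_onD[OF F]
  define fx where "fx \<epsilon> t = frechet_derivative F (at (\<epsilon>, t)) (1, 0)" for \<epsilon> t
  have sub: "ball 0 d \<times> {a..b} \<subseteq> S" using d U by auto
  have der: "((\<lambda>\<epsilon>. L (X \<epsilon> t)) has_real_derivative fx \<epsilon> t) (at \<epsilon> within ball 0 d)"
    if "\<epsilon> \<in> ball 0 d" "t \<in> {a..b}" for \<epsilon> t
  proof -
    have m: "(\<epsilon>, t) \<in> S" using that sub by auto
    have "((\<lambda>\<epsilon>. (\<epsilon>, t)) has_derivative (\<lambda>h. (h, 0))) (at \<epsilon> within ball 0 d)"
      by (auto intro!: derivative_eq_intros)
    from has_derivative_compose[OF this dF(1)[OF m]]
    have 1: "((\<lambda>\<epsilon>. F (\<epsilon>, t)) has_derivative (\<lambda>h. frechet_derivative F (at (\<epsilon>, t)) (h, 0)))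
        (at \<epsilon> within ball 0 d)" .
    have "frechet_derivative F (at (\<epsilon>, t)) (h, 0) = fx \<epsilon> t * h" for h
      using linear_scale[OF has_derivative_linear[OF dF(1)[OF m]], of h "(1, 0)"]
      by (simp add: fx_def)
    then show ?thesis using 1 by (simp add: F_def has_field_derivative_def)
  qed
  have "((\<lambda>\<epsilon>. integral (cbox a b) (\<lambda>t. L (X \<epsilon> t))) has_field_derivative integral (cbox a b) (fx 0))
      (at 0 within ball 0 d)"
  proof (rule leibniz_rule_field_derivative)
    show "(\<lambda>t. L (X \<epsilon> t)) integrable_on cbox a b" if "\<epsilon> \<in> ball 0 d" for \<epsilon>
    proof (rule integrable_continuous)
      have "continuous_on (cbox a b) (\<lambda>t. F (\<epsilon>, t))"
        by (rule continuous_on_compose2[OF dF(3)])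
           (use that sub in \<open>auto intro!: continuous_intros\<close>)
      then show "continuous_on (cbox a b) (\<lambda>t. L (X \<epsilon> t))" by (simp add: F_def)
    qed
    show "continuous_on (ball 0 d \<times> cbox a b) (\<lambda>(\<epsilon>, t). fx \<epsilon> t)"
      using continuous_on_subset[OF smooth_onD(3)[OF dF(2)[of "(1, 0)"]] sub]
      by (simp add: fx_def case_prod_beta)
  qed (use der d in auto)
  then have main: "((\<lambda>\<epsilon>. integral {a..b} (\<lambda>t. L (X \<epsilon> t))) has_real_derivative integral {a..b} (fx 0)) (at 0)"
    using d by (simp add: at_within_open[of 0 "ball 0 d"])
  \<comment> \<open>Two derivatives of the same map
    \<open>\<epsilon> \<mapsto> L (X \<epsilon> t)\<close> at 0 are compared: one from the joint
    smoothness of the family, one from the prescribed variation.\<close>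
  have "fx 0 t = frechet_derivative L (at (x t)) (vector_derivative \<eta> (at t) + br (x t) (\<eta> t))"
    if "t \<in> {a..b}" for t
  proof -
    let ?v = "vector_derivative \<eta> (at t) + br (x t) (\<eta> t)"
    have "((\<lambda>\<epsilon>. X \<epsilon> t) has_vector_derivative ?v) (at 0)" and x: "X 0 t = x t"
      using X that unfolding constrained_deformation_def by auto
    then have "((\<lambda>\<epsilon>. L (X \<epsilon> t)) has_derivative (\<lambda>h. frechet_derivative L (at (X 0 t)) (h *\<^sub>R ?v))) (at 0)"
      unfolding has_vector_derivative_def
      by (intro has_derivative_compose[OF _ smooth_onD(1)[OF L]]) auto
    moreover have "((\<lambda>\<epsilon>. L (X \<epsilon> t)) has_derivative (*) (fx 0 t)) (at 0)"
      using der[of 0 t] that d by (simp add: at_within_open[of 0 "ball 0 d"] has_field_derivative_def)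
    ultimately have "(\<lambda>h. frechet_derivative L (at (X 0 t)) (h *\<^sub>R ?v)) = (*) (fx 0 t)"
      by (rule has_derivative_unique)
    from fun_cong[OF this, of 1] show ?thesis using x by simp
  qed
  then have "integral {a..b} (fx 0) = integral {a..b}
      (\<lambda>t. frechet_derivative L (at (x t)) (vector_derivative \<eta> (at t) + br (x t) (\<eta> t)))"
    by (intro integral_cong) auto
  with main show ?thesis by simp
qed

lemma smooth_curve_vector_derivative:
  fixes x :: "real \<Rightarrow> 'a::real_normed_vector"
  assumes "smooth_on S x"
  shows "t \<in> S \<Longrightarrow> (x has_vector_derivative vector_derivative x (at t)) (at t)"
    and "open S \<Longrightarrow> smooth_on S (\<lambda>t. vector_derivative x (at t))"
proof -
  show *: "(x has_vector_derivative vector_derivative x (at t)) (at t)" if "t \<in> S" for t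
    using smooth_onD(1)[OF assms that] differentiableI vector_derivative_works by blast
  have "frechet_derivative x (at t) 1 = vector_derivative x (at t)" if "t \<in> S" for t
  proof -
    have "(\<lambda>h. h *\<^sub>R vector_derivative x (at t)) = frechet_derivative x (at t)"
      by (rule frechet_derivative_at) (rule *[OF that, unfolded has_vector_derivative_def])
    from fun_cong[OF this, of 1] show ?thesis by (simp only: scaleR_one)
  qed
  then show "smooth_on S (\<lambda>t. vector_derivative x (at t))" if "open S"
    by (rule smooth_on_cong[OF that smooth_onD(2)[OF assms]])
qed

text \<open>Evaluating on a fixed vector \<open>v\<close> keeps the equation real valued; at the end
  points the derivative within \<open>{a..b}\<close> is one-sided. Both implications rest on the
  identity \<open>weak\<close> below.\<close>

theorem euler_poincare_iff:
  fixes br :: "'h::euclidean_space \<Rightarrow> 'h \<Rightarrow> 'h" and L :: "'h \<Rightarrow> real"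
  assumes br: "bounded_bilinear br" and L: "smooth_on UNIV L" and ab: "a < b"
    and x: "smooth_curve a b x"
  shows "euler_poincare_extremal br L a b x \<longleftrightarrow>
    (\<forall>t\<in>{a..b}. \<forall>v. ((\<lambda>s. frechet_derivative L (at (x s)) v) has_vector_derivative
        frechet_derivative L (at (x t)) (br (x t) v)) (at t within {a..b}))"
proof -
  obtain S where S: "open S" "{a..b} \<subseteq> S" and xs: "smooth_on S x"
    using x unfolding smooth_curve_def by blast
  \<comment> \<open>\<open>\<mu> v t\<close> is the momentum covector \<open>DL(x(t))\<close>
    evaluated on \<open>v\<close>; \<open>\<rho> v t\<close> below is the defect in the
    Euler-Poincare equation.\<close>
  define \<mu> where "\<mu> v t = frechet_derivative L (at (x t)) v" for v t
  have lin: "linear (\<lambda>v. \<mu> v t)" for t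
    unfolding \<mu>_def by (rule has_derivative_linear[OF smooth_onD(1)[OF L]]) simp
  have \<mu>: "smooth_on S (\<mu> v)" for v
    unfolding \<mu>_def by (rule smooth_on_compose[OF S(1) open_UNIV _ xs smooth_onD(2)[OF L]]) simp
  note \<mu>' = smooth_curve_vector_derivative[OF \<mu>]
  define \<rho> where "\<rho> v t = vector_derivative (\<mu> v) (at t) - \<mu> (br (x t) v) t" for v t
  have \<mu>_expand: "\<mu> (w t) t = (\<Sum>i\<in>Basis. (w t \<bullet> i) *\<^sub>R \<mu> i t)" for w t
    using linear_basis_expansion[OF lin] by blast
  have lin_br: "linear (\<lambda>v. \<mu> (br (x t) v) t)" for t
    using linear_compose[OF bounded_linear.linear[OF bounded_bilinear.bounded_linear_right[OF br]] lin]
    by (simp add: o_def)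
  have \<mu>_smooth: "smooth_on T (\<lambda>t. \<mu> (w t) t)" if "open T" "T \<subseteq> S" "smooth_on T w" for w T
    by (subst \<mu>_expand, intro smooth_on_sum smooth_on_bounded_bilinear[OF _ bounded_bilinear_scaleR]
        smooth_on_bounded_linear[OF _ bounded_linear_inner_left] that smooth_on_subset[OF \<mu>])
  \<comment> \<open>Product rule for pairing the moving covector with a moving vector
    \<open>w\<close>; the sum is the derivative of the covector applied to
    \<open>w t\<close>.\<close>
  have \<mu>_deriv: "((\<lambda>s. \<mu> (w s) s) has_vector_derivative
      (\<Sum>i\<in>Basis. (w t \<bullet> i) *\<^sub>R vector_derivative (\<mu> i) (at t)) + \<mu> w' t) (at t)"
    if "t \<in> S" and w: "(w has_vector_derivative w') (at t)" for w w' t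
  proof -
    have "((\<lambda>s. \<Sum>i\<in>Basis. (w s \<bullet> i) *\<^sub>R \<mu> i s) has_vector_derivative
        (\<Sum>i\<in>Basis. (w t \<bullet> i) *\<^sub>R vector_derivative (\<mu> i) (at t) + (w' \<bullet> i) *\<^sub>R \<mu> i t)) (at t)"
    proof (intro has_vector_derivative_sum)
      fix i :: 'h
      have "((\<lambda>s. w s \<bullet> i) has_real_derivative w' \<bullet> i) (at t)"
        using bounded_linear.has_vector_derivative[OF bounded_linear_inner_left w]
        by (simp add: has_real_derivative_iff_has_vector_derivative)
      from has_vector_derivative_scaleR[OF this \<mu>'(1)[OF that(1)]]
      show "((\<lambda>s. (w s \<bullet> i) *\<^sub>R \<mu> i s) has_vector_derivative
        (w t \<bullet> i) *\<^sub>R vector_derivative (\<mu> i) (at t) + (w' \<bullet> i) *\<^sub>R \<mu> i t) (at t)" .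
    qed
    then show ?thesis
      by (simp add: \<mu>_expand[of w] \<mu>_expand[of "\<lambda>_. w'"] sum.distrib)
  qed
  have \<rho>_cont: "continuous_on S (\<rho> v)" for v
    unfolding \<rho>_def
    by (intro continuous_on_diff smooth_onD(3) \<mu>'(2) S(1) \<mu>_smooth
        smooth_on_bounded_bilinear[OF _ br] xs smooth_on_const) simp
  \<comment> \<open>Integration by parts: the integrand is the derivative of
    \<open>\<mu> (\<eta> t) t\<close>, whose boundary values vanish. Hence the first variation is
    minus the integral of the defect paired with \<open>\<eta>\<close>.\<close>
  have weak: "((\<lambda>t. \<mu> (vector_derivative \<eta> (at t) + br (x t) (\<eta> t)) t + (\<Sum>i\<in>Basis. (\<eta> t \<bullet> i) * \<rho> i t))
      has_integral 0) {a..b}" if \<eta>: "smooth_curve a b \<eta>" "\<eta> a = 0" "\<eta> b = 0" for \<eta>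
  proof -
    obtain T where T: "open T" "{a..b} \<subseteq> T" "smooth_on T \<eta>"
      using \<eta>(1) unfolding smooth_curve_def by blast
    have "((\<lambda>t. (\<Sum>i\<in>Basis. (\<eta> t \<bullet> i) *\<^sub>R vector_derivative (\<mu> i) (at t)) + \<mu> (vector_derivative \<eta> (at t)) t)
        has_integral (\<mu> (\<eta> b) b - \<mu> (\<eta> a) a)) {a..b}"
    proof (rule fundamental_theorem_of_calculus)
      fix t assume t: "t \<in> {a..b}"
      show "((\<lambda>t. \<mu> (\<eta> t) t) has_vector_derivative (\<Sum>i\<in>Basis. (\<eta> t \<bullet> i) *\<^sub>R vector_derivative (\<mu> i) (at t))
          + \<mu> (vector_derivative \<eta> (at t)) t) (at t within {a..b})"
        using t T(2) S(2)
        by (intro has_vector_derivative_at_within[OF \<mu>_deriv]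
            smooth_curve_vector_derivative(1)[OF T(3)]) auto
    qed (use ab in simp)
    moreover have "\<mu> (\<eta> b) b = 0" "\<mu> (\<eta> a) a = 0"
      using linear_0[OF lin] \<eta> by auto
    moreover have "\<mu> (br (x t) (\<eta> t)) t = (\<Sum>i\<in>Basis. (\<eta> t \<bullet> i) * \<mu> (br (x t) i) t)" for t
      using linear_basis_expansion[OF lin_br, of t "\<eta> t"] by simp
    then have "(\<Sum>i\<in>Basis. (\<eta> t \<bullet> i) *\<^sub>R vector_derivative (\<mu> i) (at t)) + \<mu> (vector_derivative \<eta> (at t)) t
      = \<mu> (vector_derivative \<eta> (at t) + br (x t) (\<eta> t)) t + (\<Sum>i\<in>Basis. (\<eta> t \<bullet> i) * \<rho> i t)" for t
      by (simp add: \<rho>_def linear_add[OF lin] right_diff_distrib sum_subtractf)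
    ultimately show ?thesis by simp
  qed
  have "euler_poincare_extremal br L a b x \<longleftrightarrow> (\<forall>t\<in>{a..b}. \<forall>v. \<rho> v t = 0)"
  proof
    assume ext: "euler_poincare_extremal br L a b x"
    \<comment> \<open>\<open>R\<close> represents the defect through the inner product. The weight
      \<open>(t - a) * (b - t)\<close> makes \<open>\<eta>\<close> vanish at both ends and is
      positive in between, so the defect paired with \<open>\<eta>\<close> is a nonnegative
      function.\<close>
    define R where "R t = (\<Sum>i\<in>Basis. \<rho> i t *\<^sub>R i)" for t
    define \<eta> where "\<eta> t = ((t - a) * (b - t)) *\<^sub>R R t" for t
    define \<delta> where "\<delta> t = vector_derivative \<eta> (at t) + br (x t) (\<eta> t)" for t
    \<comment> \<open>A family affine in \<open>\<epsilon>\<close> already realizes the required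
      variation \<open>\<delta>\<close>.\<close>
    define X where "X \<epsilon> t = x t + \<epsilon> *\<^sub>R \<delta> t" for \<epsilon> t
    have \<rho>s: "smooth_on S (\<rho> v)" for v
    proof -
      have "smooth_on S (\<lambda>t. vector_derivative (\<mu> v) (at t) + - \<mu> (br (x t) v) t)"
        by (intro smooth_on_add \<mu>'(2) S(1) \<mu>_smooth smooth_on_bounded_linear[OF _ bounded_linear_minus[OF bounded_linear_ident]]
          smooth_on_bounded_bilinear[OF _ br] xs smooth_on_const) simp
      then show ?thesis by (simp add: \<rho>_def[abs_def])
    qed
    have lin_smooth: "smooth_on S (\<lambda>t. t - a)" "smooth_on S (\<lambda>t. b - t)"
      using smooth_on_add[OF S(1) smooth_on_id[OF S(1)] smooth_on_const, of "- a"]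
        smooth_on_add[OF S(1) smooth_on_const smooth_on_bounded_linear[OF S(1)
          bounded_linear_minus[OF bounded_linear_ident] smooth_on_id[OF S(1)]], of b]
      by simp_all
    have Rs: "smooth_on S R"
      unfolding R_def
      by (rule smooth_on_sum[OF S(1)], rule smooth_on_bounded_bilinear[OF S(1) bounded_bilinear_scaleR])
        (rule \<rho>s smooth_on_const)+
    have "smooth_on S (\<lambda>t. ((t - a) * (b - t)) *\<^sub>R R t)"
      by (rule smooth_on_bounded_bilinear[OF S(1) bounded_bilinear_scaleR
            smooth_on_bounded_bilinear[OF S(1) bounded_bilinear_mult lin_smooth] Rs])
    then have \<eta>s: "smooth_on S \<eta>" by (simp add: \<eta>_def[abs_def])
    then have \<delta>s: "smooth_on S \<delta>"
      unfolding \<delta>_def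
      by (intro smooth_on_add smooth_curve_vector_derivative(2) S(1) smooth_on_bounded_bilinear[OF _ br] xs)
    have \<eta>: "smooth_curve a b \<eta>" "\<eta> a = 0" "\<eta> b = 0"
      using \<eta>s S by (auto simp: smooth_curve_def \<eta>_def)
    have "constrained_deformation br a b x \<eta> X"
      unfolding constrained_deformation_def
    proof (intro conjI ballI exI)
      show "open (UNIV \<times> S)" "{0} \<times> {a..b} \<subseteq> UNIV \<times> S" using S by (auto intro: open_Times)
      have "smooth_on (UNIV \<times> S) (\<lambda>p. x (snd p) + fst p *\<^sub>R \<delta> (snd p))"
        using S(1)
        by (intro smooth_on_add smooth_on_bounded_bilinear[OF _ bounded_bilinear_scaleR]
            smooth_on_compose[OF _ S(1) _ _ xs] smooth_on_compose[OF _ S(1) _ _ \<delta>s] open_Times open_UNIV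
            smooth_on_bounded_linear[OF _ bounded_linear_fst] smooth_on_bounded_linear[OF _ bounded_linear_snd]
            smooth_on_id) auto
      then show "smooth_on (UNIV \<times> S) (\<lambda>(\<epsilon>, t). X \<epsilon> t)" by (simp add: X_def case_prod_unfold)
      show "X 0 t = x t" for t by (simp add: X_def)
      show "((\<lambda>\<epsilon>. X \<epsilon> t) has_vector_derivative (vector_derivative \<eta> (at t) + br (x t) (\<eta> t))) (at 0)" for t
        unfolding X_def \<delta>_def[symmetric] by (auto intro!: derivative_eq_intros)
    qed
    then have "((\<lambda>\<epsilon>. integral {a..b} (\<lambda>t. L (X \<epsilon> t))) has_real_derivative 0) (at 0)"
      and "((\<lambda>\<epsilon>. integral {a..b} (\<lambda>t. L (X \<epsilon> t))) has_real_derivative integral {a..b} (\<lambda>t. \<mu> (\<delta> t) t)) (at 0)"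
      using ext \<eta> first_variation[OF L] unfolding euler_poincare_extremal_def \<mu>_def \<delta>_def by blast+
    then have "integral {a..b} (\<lambda>t. \<mu> (\<delta> t) t) = 0" using DERIV_unique by blast
    moreover have "(\<lambda>t. \<mu> (\<delta> t) t) integrable_on {a..b}"
      using continuous_on_subset[OF smooth_onD(3)[OF \<mu>_smooth[OF S(1) _ \<delta>s]] S(2)]
      by (intro integrable_continuous_interval) simp
    ultimately have "((\<lambda>t. \<mu> (\<delta> t) t) has_integral 0) {a..b}"
      by (metis integrable_integral)
    from has_integral_diff[OF weak[OF \<eta>] this]
    have "((\<lambda>t. \<Sum>i\<in>Basis. (\<eta> t \<bullet> i) * \<rho> i t) has_integral 0) {a..b}"
      by (simp add: \<delta>_def)
    also have "(\<lambda>t. \<Sum>i\<in>Basis. (\<eta> t \<bullet> i) * \<rho> i t) = (\<lambda>t. (t - a) * (b - t) * (\<Sum>i\<in>Basis. (\<rho> i t)\<^sup>2))"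
      by (simp add: \<eta>_def R_def inner_sum_left_Basis sum_distrib_left power2_eq_square mult.assoc)
    finally have int0: "((\<lambda>t. (t - a) * (b - t) * (\<Sum>i\<in>Basis. (\<rho> i t)\<^sup>2)) has_integral 0) (cbox a b)" by simp
    \<comment> \<open>A continuous nonnegative function with zero integral vanishes; inside the
      interval the positive weight cancels and a sum of squares remains.\<close>
    have inner: "\<rho> i t = 0" if "t \<in> {a<..<b}" "i \<in> Basis" for t i
    proof -
      have "(t - a) * (b - t) * (\<Sum>i\<in>Basis. (\<rho> i t)\<^sup>2) = 0"
      proof (rule has_integral_0_cbox_imp_0[OF _ _ int0])
        show "continuous_on (cbox a b) (\<lambda>t. (t - a) * (b - t) * (\<Sum>i\<in>Basis. (\<rho> i t)\<^sup>2))"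
          using S(2) by (auto intro!: continuous_intros continuous_on_subset[OF \<rho>_cont])
      qed (use that ab in \<open>auto intro!: mult_nonneg_nonneg sum_nonneg\<close>)
      then show ?thesis using that by (auto simp: sum_nonneg_eq_0_iff)
    qed
    \<comment> \<open>The weight is zero at the end points, so there the conclusion comes from
      continuity.\<close>
    have closed: "\<rho> i t = 0" if "t \<in> {a..b}" "i \<in> Basis" for t i
      using continuous_constant_on_closure[of "{a<..<b}" "\<rho> i" 0 t]
        continuous_on_subset[OF \<rho>_cont S(2)] inner that ab by auto
    show "\<forall>t\<in>{a..b}. \<forall>v. \<rho> v t = 0"
    proof (intro ballI allI)
      fix t v assume t: "t \<in> {a..b}"
      then have tS: "t \<in> S" using S by auto
      \<comment> \<open>With a constant \<open>w\<close>, \<open>\<mu>_deriv\<close> shows that the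
        time derivative of \<open>\<mu> v\<close> is linear in \<open>v\<close>; hence so is the
        defect, and its vanishing on the basis suffices.\<close>
      have "((\<lambda>s. \<mu> v s) has_vector_derivative
          (\<Sum>i\<in>Basis. (v \<bullet> i) *\<^sub>R vector_derivative (\<mu> i) (at t)) + \<mu> 0 t) (at t)"
        by (rule \<mu>_deriv[OF tS, of "\<lambda>_. v"]) (auto intro!: derivative_eq_intros)
      then have "vector_derivative (\<mu> v) (at t) = (\<Sum>i\<in>Basis. (v \<bullet> i) *\<^sub>R vector_derivative (\<mu> i) (at t))"
        using linear_0[OF lin] by (simp add: vector_derivative_at)
      moreover have "\<mu> (br (x t) v) t = (\<Sum>i\<in>Basis. (v \<bullet> i) * \<mu> (br (x t) i) t)"
        using linear_basis_expansion[OF lin_br, of t v] by simp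
      ultimately have "\<rho> v t = (\<Sum>i\<in>Basis. (v \<bullet> i) * \<rho> i t)"
        by (simp add: \<rho>_def right_diff_distrib sum_subtractf)
      then show "\<rho> v t = 0" using closed[OF t] by simp
    qed
  next
    assume \<rho>0: "\<forall>t\<in>{a..b}. \<forall>v. \<rho> v t = 0"
    show "euler_poincare_extremal br L a b x"
      unfolding euler_poincare_extremal_def
    proof (intro allI impI, elim conjE)
      fix \<eta> X assume \<eta>: "smooth_curve a b \<eta>" "\<eta> a = 0" "\<eta> b = 0" and X: "constrained_deformation br a b x \<eta> X"
      have "((\<lambda>t. \<mu> (vector_derivative \<eta> (at t) + br (x t) (\<eta> t)) t) has_integral 0) {a..b}"
        by (rule has_integral_eq[OF _ weak[OF \<eta>]]) (use \<rho>0 in simp)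
      then show "((\<lambda>\<epsilon>. integral {a..b} (\<lambda>t. L (X \<epsilon> t))) has_real_derivative 0) (at 0)"
        using first_variation[OF L X] by (simp add: \<mu>_def integral_unique)
    qed
  qed
  also have "\<dots> \<longleftrightarrow> (\<forall>t\<in>{a..b}. \<forall>v. (\<mu> v has_vector_derivative \<mu> (br (x t) v) t) (at t within {a..b}))"
  proof (intro ball_cong refl arg_cong[where f=All] ext)
    fix t v assume t: "t \<in> {a..b}"
    then have "(\<mu> v has_vector_derivative vector_derivative (\<mu> v) (at t)) (at t within {a..b})"
      using \<mu>'(1) S(2) has_vector_derivative_at_within by blast
    \<comment> \<open>Since \<open>a < b\<close>, the derivative within the interval is unique even
      at an end point, which gives the implication from right to left.\<close>
    then show "(\<rho> v t = 0) = (\<mu> v has_vector_derivative \<mu> (br (x t) v) t) (at t within {a..b})"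
      using vector_derivative_unique_within_closed_interval[of a b t "\<mu> v"] t ab
      unfolding \<rho>_def by auto
  qed
  finally show ?thesis by (simp add: \<mu>_def[abs_def])
qed

section \<open>Covector-valued derivatives and the semidirect bracket\<close>

text \<open>In finite dimension an operator is a finite sum of fixed bounded linear images of its
  values on the basis, so pointwise derivatives assemble into a derivative in operator norm.\<close>

lemma blinfun_has_vector_derivative_iff:
  fixes f :: "real \<Rightarrow> ('a::euclidean_space \<Rightarrow>\<^sub>L 'b::real_normed_vector)"
  shows "(f has_vector_derivative D) F \<longleftrightarrow>
    (\<forall>v. ((\<lambda>s. blinfun_apply (f s) v) has_vector_derivative blinfun_apply D v) F)"
proof safe
  fix v assume "(f has_vector_derivative D) F"
  then show "((\<lambda>s. blinfun_apply (f s) v) has_vector_derivative blinfun_apply D v) F"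
    by (rule bounded_linear.has_vector_derivative[OF blinfun.bounded_linear_left])
next
  assume *: "\<forall>v. ((\<lambda>s. blinfun_apply (f s) v) has_vector_derivative blinfun_apply D v) F"
  \<comment> \<open>\<open>E y i\<close> is the rank-one operator
    \<open>v \<mapsto> (v \<bullet> i) *\<^sub>R y\<close>.\<close>
  define E :: "'b \<Rightarrow> 'a \<Rightarrow> ('a \<Rightarrow>\<^sub>L 'b)"
    where "E y i = blinfun_scaleR_left y o\<^sub>L blinfun_inner_left i" for y i
  have E: "bounded_linear (\<lambda>y. E y i)" for i
    unfolding E_def
    by (rule bounded_linear_compose[OF bounded_bilinear.bounded_linear_left[OF bounded_bilinear_blinfun_compose]
          bounded_linear_blinfun_scaleR_left])
  have rep: "g = (\<Sum>i\<in>Basis. E (blinfun_apply g i) i)" for g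
  proof (rule blinfun_eqI)
    fix v show "blinfun_apply g v = blinfun_apply (\<Sum>i\<in>Basis. E (blinfun_apply g i) i) v"
      using linear_basis_expansion[OF bounded_linear.linear[OF blinfun.bounded_linear_right], of g v]
      by (simp add: E_def blinfun.sum_left inner_commute)
  qed
  have "((\<lambda>s. \<Sum>i\<in>Basis. E (blinfun_apply (f s) i) i) has_vector_derivative
      (\<Sum>i\<in>Basis. E (blinfun_apply D i) i)) F"
    using * by (intro has_vector_derivative_sum bounded_linear.has_vector_derivative[OF E]) auto
  then show "(f has_vector_derivative D) F"
    by (simp flip: rep)
qed

lemma frechet_derivative_partial:
  fixes L :: "'g::euclidean_space \<times> 'g \<Rightarrow> real"
  assumes "L differentiable (at (p, q))"
  shows "frechet_derivative L (at (p, q)) (v, w) =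
    blinfun_apply (partial_fst L (p, q)) v + blinfun_apply (partial_snd L (p, q)) w"
proof -
  let ?D = "frechet_derivative L (at (p, q))"
  have D: "(L has_derivative ?D) (at (p, q))" using assms frechet_derivative_works by blast
  have "((\<lambda>\<xi>. (\<xi>, q)) has_derivative (\<lambda>v. (v, 0))) (at p)" by (auto intro!: derivative_eq_intros)
  from has_derivative_compose[OF this D]
  have 1: "((\<lambda>\<xi>. L (\<xi>, q)) has_derivative (\<lambda>v. ?D (v, 0))) (at p)" .
  have "((\<lambda>\<xi>. (p, \<xi>)) has_derivative (\<lambda>v. (0, v))) (at q)" by (auto intro!: derivative_eq_intros)
  from has_derivative_compose[OF this D]
  have 2: "((\<lambda>\<xi>. L (p, \<xi>)) has_derivative (\<lambda>v. ?D (0, v))) (at q)" .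
  have "?D (v, w) = ?D (v, 0) + ?D (0, w)"
    using linear_add[OF has_derivative_linear[OF D], of "(v, 0)" "(0, w)"] by simp
  then show ?thesis
    using bounded_linear_Blinfun_apply[OF has_derivative_bounded_linear[OF 1]]
      bounded_linear_Blinfun_apply[OF has_derivative_bounded_linear[OF 2]]
    by (simp add: partial_fst_def partial_snd_def flip: frechet_derivative_at[OF 1] frechet_derivative_at[OF 2])
qed

lemma semidirect_bracket_bounded_bilinear:
  fixes br :: "'g::euclidean_space \<Rightarrow> 'g \<Rightarrow> 'g"
  assumes "bounded_bilinear br"
  shows "bounded_bilinear (semidirect_bracket br)"
proof -
  interpret bounded_bilinear br by fact
  show ?thesis
    unfolding bilinear_conv_bounded_bilinear[symmetric] bilinear_def
    by (auto intro!: linearI simp: semidirect_bracket_def add_left add_right scaleR_left scaleR_right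
        algebra_simps)
qed

lemma ad_star_apply:
  assumes "bounded_bilinear br"
  shows "blinfun_apply (ad_star br \<xi> \<mu>) v = blinfun_apply \<mu> (br \<xi> v)"
  unfolding ad_star_def
  by (subst bounded_linear_Blinfun_apply)
    (auto intro: bounded_linear_compose[OF blinfun.bounded_linear_right bounded_bilinear.bounded_linear_right[OF assms]])

text \<open>Polarization. Antisymmetry is what turns the term \<open>- br \<eta>2 \<xi>3\<close> of
  the semidirect bracket into \<open>br \<xi>3 \<eta>2\<close>, and so into
  \<open>ad_star br \<xi>3\<close>.\<close>

lemma alternating_imp_antisymmetric:
  assumes "bounded_bilinear br" "\<And>x. br x x = 0"
  shows "br x y = - br y x"
proof -
  interpret bounded_bilinear br by fact
  have "br (x + y) (x + y) = br x y + br y x"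
    unfolding add_left add_right using assms(2) by simp
  then show ?thesis using assms(2) by (simp add: eq_neg_iff_add_eq_0)
qed

text \<open>Testing the equation of \<open>euler_poincare_iff\<close> on \<open>(v, 0)\<close> and
  on \<open>(0, v)\<close> separates it into the two equations; conversely, these add up to the
  equation on any pair.\<close>

theorem euler_poincare_semidirect:
  fixes br :: "'g::euclidean_space \<Rightarrow> 'g \<Rightarrow> 'g" and L :: "'g \<times> 'g \<Rightarrow> real"
  assumes br: "bounded_bilinear br" "\<And>x. br x x = 0" and L: "smooth_on UNIV L" and ab: "a < b"
    and x: "smooth_curve a b \<xi>2" "smooth_curve a b \<xi>3"
  shows "euler_poincare_extremal (semidirect_bracket br) L a b (\<lambda>t. (\<xi>2 t, \<xi>3 t)) \<longleftrightarrow>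
    (\<forall>t\<in>{a..b}.
       ((\<lambda>s. partial_fst L (\<xi>2 s, \<xi>3 s)) has_vector_derivative
          ad_star br (\<xi>2 t) (partial_fst L (\<xi>2 t, \<xi>3 t)) +
          ad_star br (\<xi>3 t) (partial_snd L (\<xi>2 t, \<xi>3 t))) (at t within {a..b}) \<and>
       ((\<lambda>s. partial_snd L (\<xi>2 s, \<xi>3 s)) has_vector_derivative
          ad_star br (\<xi>2 t) (partial_snd L (\<xi>2 t, \<xi>3 t))) (at t within {a..b}))"
proof -
  obtain S T where S: "open S" "{a..b} \<subseteq> S" "smooth_on S \<xi>2" and T: "open T" "{a..b} \<subseteq> T" "smooth_on T \<xi>3"
    using x unfolding smooth_curve_def by blast
  have "smooth_on (S \<inter> T) (\<lambda>t. (\<xi>2 t, \<xi>3 t))"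
    by (intro smooth_on_Pair smooth_on_subset[OF S(3)] smooth_on_subset[OF T(3)] open_Int S T) auto
  then have curve: "smooth_curve a b (\<lambda>t. (\<xi>2 t, \<xi>3 t))"
    unfolding smooth_curve_def using S T by (intro exI[of _ "S \<inter> T"]) auto
  note DL = frechet_derivative_partial[OF differentiableI[OF smooth_onD(1)[OF L UNIV_I]]]
  let ?f = "\<lambda>s. partial_fst L (\<xi>2 s, \<xi>3 s)" and ?g = "\<lambda>s. partial_snd L (\<xi>2 s, \<xi>3 s)"
  have eq: "blinfun_apply (?f t) (br (\<xi>2 t) v) + blinfun_apply (?g t) (br (\<xi>2 t) w - br v (\<xi>3 t))
    = blinfun_apply (ad_star br (\<xi>2 t) (?f t) + ad_star br (\<xi>3 t) (?g t)) v
      + blinfun_apply (ad_star br (\<xi>2 t) (?g t)) w" for t v w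
    unfolding alternating_imp_antisymmetric[OF br, of v]
    by (simp add: blinfun.add_left blinfun.add_right ad_star_apply[OF br(1)])
  show ?thesis
    unfolding euler_poincare_iff[OF semidirect_bracket_bounded_bilinear[OF br(1)] L ab curve]
      blinfun_has_vector_derivative_iff
  proof (intro ball_cong refl iffI conjI allI)
    fix t v assume *: "\<forall>v. ((\<lambda>s. frechet_derivative L (at (\<xi>2 s, \<xi>3 s)) v) has_vector_derivative
        frechet_derivative L (at (\<xi>2 t, \<xi>3 t)) (semidirect_bracket br (\<xi>2 t, \<xi>3 t) v)) (at t within {a..b})"
    show "((\<lambda>s. blinfun_apply (?f s) v) has_vector_derivative
        blinfun_apply (ad_star br (\<xi>2 t) (?f t) + ad_star br (\<xi>3 t) (?g t)) v) (at t within {a..b})"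
      using *[rule_format, of "(v, 0)"] by (simp add: DL semidirect_bracket_def eq blinfun.zero_right)
    show "((\<lambda>s. blinfun_apply (?g s) v) has_vector_derivative
        blinfun_apply (ad_star br (\<xi>2 t) (?g t)) v) (at t within {a..b})"
      using *[rule_format, of "(0, v)"] by (simp add: DL semidirect_bracket_def eq blinfun.zero_right)
  next
    fix t and u :: "'g \<times> 'g" assume *: "(\<forall>v. ((\<lambda>s. blinfun_apply (?f s) v) has_vector_derivative
        blinfun_apply (ad_star br (\<xi>2 t) (?f t) + ad_star br (\<xi>3 t) (?g t)) v) (at t within {a..b})) \<and>
      (\<forall>v. ((\<lambda>s. blinfun_apply (?g s) v) has_vector_derivative
        blinfun_apply (ad_star br (\<xi>2 t) (?g t)) v) (at t within {a..b}))"
    obtain v w where u: "u = (v, w)" by fastforce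
    show "((\<lambda>s. frechet_derivative L (at (\<xi>2 s, \<xi>3 s)) u) has_vector_derivative
        frechet_derivative L (at (\<xi>2 t, \<xi>3 t)) (semidirect_bracket br (\<xi>2 t, \<xi>3 t) u)) (at t within {a..b})"
      using has_vector_derivative_add[OF *[THEN conjunct1, rule_format, of v] *[THEN conjunct2, rule_format, of w]]
      by (simp add: u DL semidirect_bracket_def eq)
  qed
qed

section \<open>Local existence and uniqueness for ordinary differential equations\<close>

text \<open>Mean value inequality on a convex set. The operator norm of the derivative is dominated
  by \<open>?g\<close>, the sum of the norms of its values on the basis, which is continuous and
  hence bounded on \<open>C\<close>.\<close>

lemma smooth_on_imp_lipschitz_on:
  fixes f :: "'a::euclidean_space \<Rightarrow> 'b::real_normed_vector"
  assumes f: "smooth_on S f" and C: "compact C" "convex C" "C \<subseteq> S"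
  obtains K where "K-lipschitz_on C f"
proof -
  note D = smooth_onD[OF f]
  let ?g = "\<lambda>x. \<Sum>i\<in>Basis. norm (frechet_derivative f (at x) i)"
  have "continuous_on C ?g"
    by (intro continuous_intros continuous_on_subset[OF smooth_onD(3)[OF D(2)] C(3)])
  then have "compact (?g ` C)" using C(1) compact_continuous_image by blast
  from compact_imp_bounded[OF this] obtain K where K: "\<And>x. x \<in> C \<Longrightarrow> \<bar>?g x\<bar> \<le> K"
    unfolding bounded_iff by force
  have "norm (f x - f y) \<le> \<bar>K\<bar> * norm (x - y)" if "x \<in> C" "y \<in> C" for x y
  proof (rule differentiable_bound[OF C(2) _ _ that(1,2)])
    fix z assume z: "z \<in> C"
    show "(f has_derivative frechet_derivative f (at z)) (at z within C)"
      using D(1) z C(3) has_derivative_at_withinI by blast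
    show "onorm (frechet_derivative f (at z)) \<le> \<bar>K\<bar>"
    proof (rule onorm_le)
      fix v
      have "norm (frechet_derivative f (at z) v)
          = norm (\<Sum>i\<in>Basis. (v \<bullet> i) *\<^sub>R frechet_derivative f (at z) i)"
        using D(1)[of z] z C(3) by (subst linear_basis_expansion[of "frechet_derivative f (at z)" v])
          (auto intro: has_derivative_linear)
      also have "\<dots> \<le> (\<Sum>i\<in>Basis. norm v * norm (frechet_derivative f (at z) i))"
        by (intro sum_norm_le) (auto intro!: mult_right_mono Basis_le_norm)
      also have "\<dots> = norm v * ?g z" by (simp add: sum_distrib_left)
      also have "\<dots> \<le> norm v * \<bar>K\<bar>" using K[OF z] by (intro mult_left_mono) auto
      finally show "norm (frechet_derivative f (at z) v) \<le> \<bar>K\<bar> * norm v" by (simp add: mult.commute)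
    qed
  qed
  then have "\<bar>K\<bar>-lipschitz_on C f"
    by (intro lipschitz_onI) (auto simp: dist_norm)
  then show thesis by (rule that)
qed

text \<open>A Gronwall estimate for the squared distance of the two solutions: multiplied by
  \<open>exp (- (2 * K) * t)\<close> it cannot increase forward in time, and multiplied by
  \<open>exp (2 * K * t)\<close> it cannot increase backward from 0. It starts at zero.\<close>

lemma ode_unique:
  fixes u v :: "real \<Rightarrow> 'a::real_inner"
  assumes F: "K-lipschitz_on B F" and uv: "u 0 = v 0"
    and u: "\<And>t. \<bar>t\<bar> < h \<Longrightarrow> u t \<in> B \<and> (u has_vector_derivative F (u t)) (at t)"
    and v: "\<And>t. \<bar>t\<bar> < h \<Longrightarrow> v t \<in> B \<and> (v has_vector_derivative F (v t)) (at t)"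
    and t: "\<bar>t\<bar> < h"
  shows "u t = v t"
proof -
  define w where "w s = u s - v s" for s
  define w' where "w' s = F (u s) - F (v s)" for s
  have w: "((\<lambda>s. w s \<bullet> w s) has_real_derivative 2 * (w s \<bullet> w' s)) (at s)" if "\<bar>s\<bar> < h" for s
  proof -
    have "(w has_vector_derivative w' s) (at s)"
      unfolding w_def w'_def using u[OF that] v[OF that] by (intro has_vector_derivative_diff) auto
    then show ?thesis
      unfolding has_vector_derivative_def has_field_derivative_def
      by (auto intro!: derivative_eq_intros simp: inner_commute algebra_simps)
  qed
  have bound: "\<bar>w s \<bullet> w' s\<bar> \<le> K * (w s \<bullet> w s)" if "\<bar>s\<bar> < h" for s
  proof -
    have "norm (w' s) \<le> K * norm (w s)"
      using lipschitz_onD[OF F, of "u s" "v s"] u[OF that] v[OF that]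
      by (simp add: w_def w'_def dist_norm)
    then have "norm (w s) * norm (w' s) \<le> norm (w s) * (K * norm (w s))"
      by (rule mult_left_mono) simp
    then show ?thesis
      using Cauchy_Schwarz_ineq2[of "w s" "w' s"]
      by (simp add: power2_norm_eq_inner[symmetric] power2_eq_square mult_ac)
  qed
  have "w t \<bullet> w t \<le> 0"
  proof (cases "t \<ge> 0")
    case True
    have "(w t \<bullet> w t) * exp (- (2 * K) * t) \<le> (w 0 \<bullet> w 0) * exp (- (2 * K) * 0)"
    proof (rule DERIV_nonpos_imp_nonincreasing[OF True])
      fix s assume "0 \<le> s" "s \<le> t"
      then have s: "\<bar>s\<bar> < h" using t by auto
      have "2 * (w s \<bullet> w' s) * exp (- (2 * K) * s)
          + (w s \<bullet> w s) * (- (2 * K) * exp (- (2 * K) * s)) \<le> 0"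
        using bound[OF s] mult_right_mono[of "w s \<bullet> w' s" "K * (w s \<bullet> w s)" "exp (- (2 * K) * s)"]
        by (simp add: algebra_simps)
      moreover have "((\<lambda>s. (w s \<bullet> w s) * exp (- (2 * K) * s)) has_real_derivative
          2 * (w s \<bullet> w' s) * exp (- (2 * K) * s) + (w s \<bullet> w s) * (- (2 * K) * exp (- (2 * K) * s))) (at s)"
        by (auto intro!: derivative_eq_intros w[OF s])
      ultimately show "\<exists>y. ((\<lambda>s. (w s \<bullet> w s) * exp (- (2 * K) * s)) has_real_derivative y) (at s) \<and> y \<le> 0"
        by blast
    qed
    then show ?thesis using uv by (simp add: w_def mult_le_0_iff)
  next
    case False
    have "(w t \<bullet> w t) * exp (2 * K * t) \<le> (w 0 \<bullet> w 0) * exp (2 * K * 0)"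
    proof (rule DERIV_nonneg_imp_nondecreasing[of t 0])
      fix s assume "t \<le> s" "s \<le> 0"
      then have s: "\<bar>s\<bar> < h" using t by auto
      have "0 \<le> 2 * (w s \<bullet> w' s) * exp (2 * K * s) + (w s \<bullet> w s) * (2 * K * exp (2 * K * s))"
      proof -
        have "- (w s \<bullet> w' s) \<le> K * (w s \<bullet> w s)" using bound[OF s] by linarith
        from mult_right_mono[OF this, of "exp (2 * K * s)"] show ?thesis by (simp add: algebra_simps)
      qed
      moreover have "((\<lambda>s. (w s \<bullet> w s) * exp (2 * K * s)) has_real_derivative
          2 * (w s \<bullet> w' s) * exp (2 * K * s) + (w s \<bullet> w s) * (2 * K * exp (2 * K * s))) (at s)"
        by (auto intro!: derivative_eq_intros w[OF s])
      ultimately show "\<exists>y. ((\<lambda>s. (w s \<bullet> w s) * exp (2 * K * s)) has_real_derivative y) (at s) \<and> 0 \<le> y"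
        by blast
    qed (use False in simp)
    then show ?thesis using uv by (simp add: w_def mult_le_0_iff)
  qed
  then have "w t \<bullet> w t = 0" using inner_ge_zero[of "w t"] by linarith
  then show ?thesis by (simp add: w_def)
qed

text \<open>The difference is the oriented integral of \<open>g\<close> from 0 to \<open>c\<close>;
  basing both integrals at \<open>- h\<close> treats the two signs of \<open>c\<close>
  together.\<close>

lemma norm_integral_diff_le:
  fixes g :: "real \<Rightarrow> 'a::banach"
  assumes g: "continuous_on {- h..h} g" and M: "\<And>s. s \<in> {- h..h} \<Longrightarrow> norm (g s) \<le> M" and c: "\<bar>c\<bar> \<le> h"
  shows "norm (integral {- h..c} g - integral {- h..0} g) \<le> M * \<bar>c\<bar>"
proof -
  have "norm (integral {- h..c} g - integral {- h..0} g) \<le> M * norm (c - 0)"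
  proof (rule differentiable_bound[of "{- h..h}" _ "\<lambda>s d. d *\<^sub>R g s"])
    fix s assume s: "s \<in> {- h..h}"
    show "((\<lambda>s. integral {- h..s} g) has_derivative (\<lambda>d. d *\<^sub>R g s)) (at s within {- h..h})"
      using integral_has_vector_derivative[OF g s] by (simp add: has_vector_derivative_def)
    show "onorm (\<lambda>d. d *\<^sub>R g s) \<le> M"
    proof (rule onorm_le)
      show "norm (d *\<^sub>R g s) \<le> M * norm d" for d
        using mult_left_mono[OF M[OF s], of "\<bar>d\<bar>"] by (simp add: mult.commute)
    qed
  qed (use c in auto)
  then show ?thesis by simp
qed

text \<open>Picard's theorem: the solution is the fixed point of the integral operator, a
  contraction on the bounded continuous functions for small \<open>h\<close>.\<close>

lemma ode_exists:
  fixes F :: "'a::euclidean_space \<Rightarrow> 'a"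
  assumes F: "K-lipschitz_on (cball p r) F" and r: "r > 0"
  obtains h u where "h > 0" "u 0 = p"
    "\<And>t. \<bar>t\<bar> < h \<Longrightarrow> u t \<in> cball p r \<and> (u has_vector_derivative F (u t)) (at t)"
proof -
  \<comment> \<open>Composing with the nearest-point projection onto the ball extends
    \<open>F\<close> to the whole space. The projection is nonexpansive, so the constant
    \<open>K\<close> and the bound \<open>M\<close> persist, and no invariant subset of functions
    has to be singled out.\<close>
  define E where "E x = F (closest_point (cball p r) x)" for x
  have cp: "closest_point (cball p r) x \<in> cball p r" for x
    using r by (intro closest_point_in_set) auto
  have "continuous_on (cball p r) F" using F by (rule lipschitz_on_continuous_on)
  then have "compact (F ` cball p r)" by (intro compact_continuous_image) auto
  then obtain M where M: "M > 0" "\<And>x. x \<in> cball p r \<Longrightarrow> norm (F x) \<le> M"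
    using compact_imp_bounded bounded_pos by (metis imageI)
  have K: "K \<ge> 0" using F by (rule lipschitz_on_nonneg)
  have EM: "norm (E x) \<le> M" for x using M cp by (simp add: E_def)
  have EK: "norm (E x - E y) \<le> K * dist x y" for x y
  proof -
    have "dist (E x) (E y) \<le> K * dist (closest_point (cball p r) x) (closest_point (cball p r) y)"
      unfolding E_def by (rule lipschitz_onD[OF F cp cp])
    also have "\<dots> \<le> K * dist x y"
      using r K by (intro mult_left_mono closest_point_lipschitz) auto
    finally show ?thesis by (simp add: dist_norm)
  qed
  have Ec: "continuous_on UNIV E"
    by (rule lipschitz_on_continuous_on[of K]) (auto intro!: lipschitz_onI K simp: dist_norm EK[unfolded dist_norm])
  \<comment> \<open>The first term makes the operator contract by \<open>1 / 2\<close>, with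
    \<open>K + 1\<close> covering \<open>K = 0\<close>; the second keeps the solution within
    distance \<open>r\<close> of \<open>p\<close>.\<close>
  define h where "h = min (1 / (2 * (K + 1))) (r / M)"
  have h: "h > 0" "K * h \<le> 1 / 2" "M * h \<le> r"
  proof -
    show "h > 0" using K M r by (simp add: h_def)
    have "K * h \<le> (K + 1) * (1 / (2 * (K + 1)))"
      using K \<open>h > 0\<close> by (intro mult_mono) (auto simp: h_def)
    also have "\<dots> = 1 / 2" using K by (simp add: divide_simps)
    finally show "K * h \<le> 1 / 2" .
    have "M * h \<le> M * (r / M)" using M by (intro mult_left_mono) (auto simp: h_def)
    then show "M * h \<le> r" using M by simp
  qed
  \<comment> \<open>Clamping time to \<open>{- h..h}\<close> produces bounded functions on the whole
    line, as the complete space in use demands.\<close>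
  define cl where "cl t = max (- h) (min h t)" for t
  have cl: "\<bar>cl t\<bar> \<le> h" "cl t \<in> {- h..h}" for t using h by (auto simp: cl_def)
  define J :: "(real \<Rightarrow>\<^sub>C 'a) \<Rightarrow> real \<Rightarrow> 'a" where
    "J y t = integral {- h..t} (\<lambda>s. E (apply_bcontfun y s)) - integral {- h..0} (\<lambda>s. E (apply_bcontfun y s))" for y t
  have Ey: "continuous_on T (\<lambda>s. E (apply_bcontfun y s))" for y T
    by (rule continuous_on_compose2[OF Ec]) (auto intro: continuous_intros)
  have J': "(J y has_vector_derivative E (apply_bcontfun y t)) (at t within {- h..h})" if "t \<in> {- h..h}" for y t
    unfolding J_def
    using has_vector_derivative_diff[OF integral_has_vector_derivative[OF Ey that] has_vector_derivative_const]
    by simp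
  have JM: "norm (J y t) \<le> r" if "\<bar>t\<bar> \<le> h" for y t
  proof -
    have "norm (J y t) \<le> M * \<bar>t\<bar>"
      unfolding J_def by (rule norm_integral_diff_le[OF Ey EM that])
    also have "\<dots> \<le> M * h" using that M by (intro mult_left_mono) auto
    finally show ?thesis using h by simp
  qed
  have bc: "(\<lambda>t. p + J y (cl t)) \<in> bcontfun" for y
  proof (rule bcontfun_normI)
    have "continuous_on {- h..h} (J y)"
      using J' by (meson continuous_on_vector_derivative)
    then have "continuous_on UNIV (\<lambda>t. J y (cl t))"
      by (rule continuous_on_compose2) (use cl in \<open>auto simp: cl_def intro!: continuous_intros\<close>)
    then show "continuous_on UNIV (\<lambda>t. p + J y (cl t))" by (intro continuous_intros)
    show "norm (p + J y (cl t)) \<le> norm p + r" for t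
      using norm_triangle_ineq[of p "J y (cl t)"] JM[OF cl(1)[of t], of y] by linarith
  qed
  define P where "P y = Bcontfun (\<lambda>t. p + J y (cl t))" for y
  have P: "apply_bcontfun (P y) t = p + J y (cl t)" for y t
    unfolding P_def by (simp add: Bcontfun_inverse[OF bc])
  have "\<exists>!y. P y = y"
  proof (rule banach_fix_type[of "1 / 2"])
    show "\<forall>y z. dist (P y) (P z) \<le> 1 / 2 * dist y z"
    proof (intro allI dist_bound)
      fix y z t
      have "dist (apply_bcontfun (P y) t) (apply_bcontfun (P z) t) = norm (J y (cl t) - J z (cl t))"
        by (simp add: P dist_norm)
      also have "J y (cl t) - J z (cl t) =
          integral {- h..cl t} (\<lambda>s. E (apply_bcontfun y s) - E (apply_bcontfun z s))
          - integral {- h..0} (\<lambda>s. E (apply_bcontfun y s) - E (apply_bcontfun z s))"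
        unfolding J_def by (subst (1 2) integral_diff) (auto intro!: integrable_continuous_interval Ey)
      also have "norm \<dots> \<le> (K * dist y z) * \<bar>cl t\<bar>"
      proof (rule norm_integral_diff_le[OF _ _ cl(1)])
        fix s
        show "norm (E (apply_bcontfun y s) - E (apply_bcontfun z s)) \<le> K * dist y z"
          using EK[of "apply_bcontfun y s" "apply_bcontfun z s"] mult_left_mono[OF dist_bounded[of y s z] K] by linarith
      qed (intro continuous_intros Ey)
      also have "\<dots> \<le> (K * dist y z) * h" using cl K by (intro mult_left_mono) auto
      also have "\<dots> = (K * h) * dist y z" by simp
      also have "\<dots> \<le> 1 / 2 * dist y z" using h by (intro mult_right_mono) auto
      finally show "dist (apply_bcontfun (P y) t) (apply_bcontfun (P z) t) \<le> 1 / 2 * dist y z" .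
    qed
  qed auto
  then obtain y where y: "P y = y" by blast
  let ?u = "apply_bcontfun y"
  have u: "?u t = p + J y t" if "\<bar>t\<bar> \<le> h" for t
  proof -
    have "cl t = t" using that by (auto simp: cl_def)
    then show ?thesis using P[of y t] y by simp
  qed
  show thesis
  proof (rule that[of h ?u])
    show "h > 0" by fact
    show "?u 0 = p" using u[of 0] h by (simp add: J_def)
    fix t assume t: "\<bar>t\<bar> < h"
    have B: "?u t \<in> cball p r" using u[of t] JM[of t y] t by (simp add: dist_norm)
    have "((\<lambda>t. p + J y t) has_vector_derivative E (?u t)) (at t within {- h..h})"
      using has_vector_derivative_add[OF has_vector_derivative_const J'[of t y]] t by (auto simp: abs_less_iff)
    then have "((\<lambda>t. p + J y t) has_vector_derivative E (?u t)) (at t)"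
      using t by (simp add: at_within_Icc_at abs_less_iff)
    then have "(?u has_vector_derivative E (?u t)) (at t)"
      by (rule has_vector_derivative_transform_within_open[where S="{- h<..<h}"])
        (use t u in auto)
    \<comment> \<open>The solution stays in the ball, where the projection is the identity, so it
      solves the original equation.\<close>
    moreover have "E (?u t) = F (?u t)" using B by (simp add: E_def closest_point_self)
    ultimately show "?u t \<in> cball p r \<and> (?u has_vector_derivative F (?u t)) (at t)" using B by simp
  qed
qed

section \<open>One-parameter subgroups\<close>

text \<open>A homomorphism law valid only near 0 is enough: all intermediate multiples of
  \<open>s\<close> are no larger than \<open>real n * s\<close>.\<close>

lemma (in group) real_hom_pow:
  fixes \<gamma> :: "real \<Rightarrow> 'a"
  assumes closed: "\<And>t. \<gamma> t \<in> carrier G"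
    and hom: "\<And>s t. \<bar>s\<bar> < h \<Longrightarrow> \<bar>t\<bar> < h \<Longrightarrow> \<gamma> (s + t) = \<gamma> s \<otimes> \<gamma> t"
    and s: "\<bar>real n * s\<bar> < h"
  shows "\<gamma> (real n * s) = \<gamma> s [^] n"
  using s
proof (induction n)
  case 0
  then have "\<gamma> 0 = \<gamma> 0 \<otimes> \<gamma> 0" using hom[of 0 0] by simp
  then have "\<gamma> 0 = \<one>" using closed[of 0] by simp
  then show ?case by simp
next
  case (Suc n)
  have le: "\<bar>real n * s\<bar> \<le> \<bar>real (Suc n) * s\<bar>" "\<bar>s\<bar> \<le> \<bar>real (Suc n) * s\<bar>"
    unfolding abs_mult using mult_right_mono[of 1 "real (Suc n)" "\<bar>s\<bar>"] by (auto intro!: mult_right_mono)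
  then have "\<gamma> (real n * s + s) = \<gamma> (real n * s) \<otimes> \<gamma> s"
    using Suc.prems by (intro hom) linarith+
  then show ?case using Suc le by (simp add: algebra_simps)
qed

text \<open>Every \<open>t\<close> is a multiple of some \<open>t / real n\<close> of size below
  \<open>h\<close>, so the values near 0 determine all others as powers.\<close>

lemma (in group) real_hom_eqI:
  fixes \<gamma> \<gamma>' :: "real \<Rightarrow> 'a"
  assumes "\<And>t. \<gamma> t \<in> carrier G" "\<And>t. \<gamma>' t \<in> carrier G"
    and "\<And>s t. \<gamma> (s + t) = \<gamma> s \<otimes> \<gamma> t" "\<And>s t. \<gamma>' (s + t) = \<gamma>' s \<otimes> \<gamma>' t"
    and h: "h > 0" and eq: "\<And>t. \<bar>t\<bar> < h \<Longrightarrow> \<gamma> t = \<gamma>' t"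
  shows "\<gamma> = \<gamma>'"
proof
  fix t
  obtain n where n: "\<bar>t\<bar> < real n * h" using reals_Archimedean3[OF h] by blast
  then have "n \<noteq> 0" by (intro notI) auto
  then have t: "t = real n * (t / real n)" "\<bar>t / real n\<bar> < h"
    using n by (auto simp: field_simps abs_divide)
  have "\<gamma> (real n * (t / real n)) = \<gamma> (t / real n) [^] n"
    "\<gamma>' (real n * (t / real n)) = \<gamma>' (t / real n) [^] n"
    by (rule real_hom_pow[where h="\<bar>real n * (t / real n)\<bar> + 1"]; use assms(1-4) in simp)+
  then show "\<gamma> t = \<gamma>' t" using eq[OF t(2)] t(1) by metis
qed

text \<open>The extension at \<open>t\<close> is the \<open>n\<close>-th power of
  \<open>\<gamma> (t / real n)\<close> for any \<open>n\<close> with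
  \<open>\<bar>t / real n\<bar> < h\<close>. Two choices \<open>n\<close> and \<open>m\<close> agree
  through their common refinement \<open>n * m\<close>. The law for sums follows with a common
  \<open>n\<close>, because nearby values of \<open>\<gamma>\<close> commute.\<close>

lemma (in group) local_real_hom_extends:
  fixes \<gamma> :: "real \<Rightarrow> 'a"
  assumes closed: "\<And>t. \<gamma> t \<in> carrier G" and h: "h > 0"
    and hom: "\<And>s t. \<bar>s\<bar> < h \<Longrightarrow> \<bar>t\<bar> < h \<Longrightarrow> \<gamma> (s + t) = \<gamma> s \<otimes> \<gamma> t"
  obtains \<Gamma> where "\<And>t. \<Gamma> t \<in> carrier G" "\<And>s t. \<Gamma> (s + t) = \<Gamma> s \<otimes> \<Gamma> t" "\<And>t. \<bar>t\<bar> < h \<Longrightarrow> \<Gamma> t = \<gamma> t"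
proof -
  define good where "good t n \<longleftrightarrow> \<bar>t\<bar> < real n * h" for t and n :: nat
  have good_pos: "n > 0 \<and> \<bar>t / real n\<bar> < h" if "good t n" for t n
  proof -
    have "n \<noteq> 0" using that by (intro notI) (auto simp: good_def)
    then show ?thesis using that by (auto simp: good_def field_simps abs_divide)
  qed
  have refine: "\<gamma> (t / real n) [^] n = \<gamma> (t / (real n * real m)) [^] (n * m)" if "good t n" "m > 0" for t n m
  proof -
    have e: "t / real n = real m * (t / (real n * real m))" using that by simp
    have "\<gamma> (t / real n) = \<gamma> (t / (real n * real m)) [^] m"
      by (subst e, rule real_hom_pow[OF closed hom]) (use good_pos[OF that(1)] that(2) in \<open>auto simp: e[symmetric]\<close>)
    then show ?thesis using closed by (simp add: nat_pow_pow mult.commute)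
  qed
  define \<Gamma> where "\<Gamma> t = (let n = SOME n. good t n in \<gamma> (t / real n) [^] n)" for t
  have \<Gamma>: "\<Gamma> t = \<gamma> (t / real n) [^] n" if n: "good t n" for t n
  proof -
    define m where "m = (SOME n. good t n)"
    have m: "good t m" unfolding m_def by (rule someI[of "good t", OF n])
    have "\<gamma> (t / real m) [^] m = \<gamma> (t / real n) [^] n"
      using refine[OF m, of n] refine[OF n, of m] good_pos[OF m] good_pos[OF n]
      by (simp add: mult.commute)
    then show ?thesis by (simp add: \<Gamma>_def m_def[symmetric])
  qed
  show thesis
  proof (rule that)
    show "\<Gamma> t \<in> carrier G" for t by (simp add: \<Gamma>_def Let_def closed)
    show "\<Gamma> t = \<gamma> t" if "\<bar>t\<bar> < h" for t
      using \<Gamma>[of t 1] that closed by (simp add: good_def)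
    fix s t
    obtain n where n: "\<bar>s\<bar> + \<bar>t\<bar> < real n * h" using reals_Archimedean3[OF h] by blast
    then have g: "good s n" "good t n" "good (s + t) n" by (auto simp: good_def)
    let ?s = "s / real n" and ?t = "t / real n"
    have st: "\<gamma> (?s + ?t) = \<gamma> ?s \<otimes> \<gamma> ?t" "\<gamma> (?t + ?s) = \<gamma> ?t \<otimes> \<gamma> ?s"
      using g good_pos by (auto intro!: hom)
    then have "\<gamma> ?s \<otimes> \<gamma> ?t = \<gamma> ?t \<otimes> \<gamma> ?s" by (simp add: add.commute)
    then have "(\<gamma> ?s \<otimes> \<gamma> ?t) [^] n = \<gamma> ?s [^] n \<otimes> \<gamma> ?t [^] n"
      by (rule pow_mult_distrib) (rule closed)+
    then show "\<Gamma> (s + t) = \<Gamma> s \<otimes> \<Gamma> t"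
      using \<Gamma>[OF g(1)] \<Gamma>[OF g(2)] \<Gamma>[OF g(3)] st by (simp add: add_divide_distrib)
  qed
qed

section \<open>A Lie group in a chart at the identity\<close>

locale lie_chart = group G
  for G :: "'m::{t2_space, second_countable_topology} monoid" (structure) +
  fixes A :: "('m, 'g::euclidean_space) chart set" and U :: "'m set" and \<phi> :: "'m \<Rightarrow> 'g"
  assumes lie: "lie_group G A" and chart: "(U, \<phi>) \<in> A" and one_U: "\<one> \<in> U"
begin

definition V :: "'g set" where "V = \<phi> ` U"
definition \<psi> :: "'g \<Rightarrow> 'm" where "\<psi> = inv_into U \<phi>"
definition p :: 'g where "p = \<phi> \<one>"
text \<open>Multiplication in coordinates. The formula is total, but carries geometric meaning only
  on \<open>W\<close>, where factors and product lie in the chart; \<open>\<iota>\<close> and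
  \<open>N\<close> play the same roles for inversion.\<close>

definition \<mu> :: "'g \<times> 'g \<Rightarrow> 'g" where "\<mu> = (\<lambda>(x, y). \<phi> (\<psi> x \<otimes> \<psi> y))"
definition W :: "('g \<times> 'g) set" where "W = {(x, y). x \<in> V \<and> y \<in> V \<and> \<psi> x \<otimes> \<psi> y \<in> U}"
definition \<iota> :: "'g \<Rightarrow> 'g" where "\<iota> x = \<phi> (inv\<^bsub>G\<^esub> (\<psi> x))"
definition N :: "'g set" where "N = {x \<in> V. inv\<^bsub>G\<^esub> (\<psi> x) \<in> U}"

lemma carrier [simp]: "carrier G = UNIV"
  using lie by (simp add: lie_group_def)

lemma
  shows open_U: "open U" and open_V: "open V"
    and cont_\<phi>: "continuous_on U \<phi>" and cont_\<psi>: "continuous_on V \<psi>" and inj_\<phi>: "inj_on \<phi> U"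
proof -
  have "is_chart (U, \<phi>)" using lie chart unfolding lie_group_def smooth_atlas_def by blast
  then have c: "open U" "open V" "homeomorphism U V \<phi> \<psi>"
    by (auto simp: is_chart_def V_def \<psi>_def)
  then show "open U" "open V" "continuous_on U \<phi>" "continuous_on V \<psi>"
    by (simp_all add: homeomorphism_cont1 homeomorphism_cont2)
  show "inj_on \<phi> U" by (rule inj_on_inverseI[of _ \<psi>]) (rule homeomorphism_apply1[OF c(3)])
qed

lemma \<psi>_\<phi> [simp]: "g \<in> U \<Longrightarrow> \<psi> (\<phi> g) = g"
  by (simp add: \<psi>_def inj_\<phi>)

lemma \<phi>_V [simp]: "g \<in> U \<Longrightarrow> \<phi> g \<in> V"
  by (simp add: V_def)

lemma \<phi>_\<psi> [simp]: "x \<in> V \<Longrightarrow> \<phi> (\<psi> x) = x"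
  and \<psi>_U [simp]: "x \<in> V \<Longrightarrow> \<psi> x \<in> U"
  by (auto simp: V_def)

lemma p_V [simp]: "p \<in> V" and \<psi>_p [simp]: "\<psi> p = \<one>"
  by (simp_all add: p_def one_U)

lemma cont_mult: "continuous_on UNIV (\<lambda>(g, h). g \<otimes> h)"
  and cont_inv: "continuous_on UNIV (\<lambda>g. inv\<^bsub>G\<^esub> g)"
  using lie by (simp_all add: lie_group_def smooth_map_def)

lemma continuous_on_mult:
  "continuous_on S f \<Longrightarrow> continuous_on S g \<Longrightarrow> continuous_on S (\<lambda>x. f x \<otimes> g x)"
  using continuous_on_compose2[OF cont_mult, of S "\<lambda>x. (f x, g x)"] by (simp add: continuous_on_Pair)

lemma open_W: "open W"
proof -
  have "open ((V \<times> V) \<inter> (\<lambda>q. \<psi> (fst q) \<otimes> \<psi> (snd q)) -` U)"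
    using open_V
    by (intro continuous_open_preimage continuous_on_mult open_Times open_U
        continuous_on_compose2[OF cont_\<psi>]) (auto intro!: continuous_intros)
  also have "\<dots> = W" by (auto simp: W_def)
  finally show ?thesis .
qed

lemma open_N: "open N"
proof -
  have "open (V \<inter> (\<lambda>x. inv\<^bsub>G\<^esub> (\<psi> x)) -` U)"
    by (intro continuous_open_preimage open_V open_U continuous_on_compose2[OF cont_inv] cont_\<psi>) auto
  also have "\<dots> = N" by (auto simp: N_def)
  finally show ?thesis .
qed

lemma smooth_\<mu>: "smooth_on W \<mu>"
proof -
  have "(U \<times> U, map_prod \<phi> \<phi>) \<in> prod_atlas A A"
    using chart by (auto simp: prod_atlas_def)
  then have "smooth_on (map_prod \<phi> \<phi> ` (U \<times> U \<inter> (\<lambda>(g, h). g \<otimes> h) -` U))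
      (\<phi> \<circ> (\<lambda>(g, h). g \<otimes> h) \<circ> inv_into (U \<times> U) (map_prod \<phi> \<phi>))" (is "smooth_on ?W ?f")
    using lie chart unfolding lie_group_def smooth_map_def by blast
  moreover have "?W = W"
  proof (intro equalityI subsetI)
    fix q assume "q \<in> W"
    then obtain x y where "q = (x, y)" "x \<in> V" "y \<in> V" "\<psi> x \<otimes> \<psi> y \<in> U" by (auto simp: W_def)
    then show "q \<in> ?W" by (intro image_eqI[of _ _ "(\<psi> x, \<psi> y)"]) auto
  qed (auto simp: W_def)
  ultimately have *: "smooth_on W ?f" by simp
  have inj: "inj_on (map_prod \<phi> \<phi>) (U \<times> U)" using inj_\<phi> by (auto simp: inj_on_def)
  show ?thesis
  proof (rule smooth_on_cong[OF open_W *])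
    fix q assume "q \<in> W"
    then obtain x y where q: "q = (x, y)" "x \<in> V" "y \<in> V" by (auto simp: W_def)
    \<comment> \<open>The inverse of the product chart is the product of the inverses on the image
      of the chart, so the smoothness given by the atlas transfers to \<open>\<mu>\<close> on
      \<open>W\<close> by congruence.\<close>
    have "inv_into (U \<times> U) (map_prod \<phi> \<phi>) (map_prod \<phi> \<phi> (\<psi> x, \<psi> y)) = (\<psi> x, \<psi> y)"
      using q by (intro inv_into_f_f inj) auto
    then show "?f q = \<mu> q" using q by (simp add: \<mu>_def)
  qed
qed

lemma smooth_\<iota>: "smooth_on N \<iota>"
proof -
  have "smooth_on (\<phi> ` (U \<inter> (\<lambda>g. inv\<^bsub>G\<^esub> g) -` U)) (\<phi> \<circ> (\<lambda>g. inv\<^bsub>G\<^esub> g) \<circ> inv_into U \<phi>)" (is "smooth_on ?N _")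
    using lie chart unfolding lie_group_def smooth_map_def by blast
  moreover have "?N = N"
  proof (intro equalityI subsetI)
    fix x assume "x \<in> N"
    then show "x \<in> ?N" by (intro image_eqI[of _ _ "\<psi> x"]) (auto simp: N_def)
  qed (auto simp: N_def)
  ultimately show ?thesis by (simp add: \<iota>_def[abs_def] \<psi>_def comp_def)
qed

lemma W_p: "x \<in> V \<Longrightarrow> (x, p) \<in> W" "x \<in> V \<Longrightarrow> (p, x) \<in> W"
  and \<mu>_p: "x \<in> V \<Longrightarrow> \<mu> (x, p) = x" "x \<in> V \<Longrightarrow> \<mu> (p, x) = x"
  by (auto simp: W_def \<mu>_def)

lemma W_D: "(x, y) \<in> W \<Longrightarrow> x \<in> V" "(x, y) \<in> W \<Longrightarrow> y \<in> V" "(x, y) \<in> W \<Longrightarrow> \<mu> (x, y) \<in> V"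
  and \<psi>_\<mu>: "(x, y) \<in> W \<Longrightarrow> \<psi> (\<mu> (x, y)) = \<psi> x \<otimes> \<psi> y"
  by (auto simp: W_def \<mu>_def)

lemma \<mu>_assoc:
  assumes "(x, y) \<in> W" "(y, z) \<in> W" "(\<mu> (x, y), z) \<in> W"
  shows "(x, \<mu> (y, z)) \<in> W" "\<mu> (x, \<mu> (y, z)) = \<mu> (\<mu> (x, y), z)"
  using assms by (auto simp: W_def \<mu>_def m_assoc)

abbreviation D\<mu> :: "'g \<times> 'g \<Rightarrow> 'g \<times> 'g \<Rightarrow> 'g" where
  "D\<mu> q \<equiv> frechet_derivative \<mu> (at q)"

lemma D\<mu>: "q \<in> W \<Longrightarrow> (\<mu> has_derivative D\<mu> q) (at q)"
  by (rule smooth_onD(1)[OF smooth_\<mu>])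

text \<open>The left invariant vector field with value \<open>\<xi>\<close> at the identity: the
  derivative at the identity of right-factor variation in \<open>x z\<close>.\<close>

definition left_field :: "'g \<Rightarrow> 'g \<Rightarrow> 'g" where "left_field \<xi> x = D\<mu> (x, p) (0, \<xi>)"

lemma smooth_left_field: "smooth_on V (left_field \<xi>)"
  unfolding left_field_def
  by (rule smooth_on_compose[OF open_V open_W _ _ smooth_onD(2)[OF smooth_\<mu>]])
    (auto intro!: smooth_on_Pair open_V smooth_on_id smooth_on_const W_p)

lemma has_derivative_\<mu>_right:
  assumes "(x, y) \<in> W" "(f has_derivative f') (at s)" "f s = y"
  shows "((\<lambda>s. \<mu> (x, f s)) has_derivative (\<lambda>d. D\<mu> (x, y) (0, f' d))) (at s)"
proof -
  have "((\<lambda>s. (x, f s)) has_derivative (\<lambda>d. (0, f' d))) (at s)"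
    by (auto intro!: derivative_eq_intros assms(2))
  from has_derivative_compose[OF this, of \<mu> "D\<mu> (x, y)"] show ?thesis
    using assms D\<mu> by simp
qed

lemma has_derivative_\<mu>_left:
  assumes "(x, y) \<in> W" "(f has_derivative f') (at s)" "f s = x"
  shows "((\<lambda>s. \<mu> (f s, y)) has_derivative (\<lambda>d. D\<mu> (x, y) (f' d, 0))) (at s)"
proof -
  have "((\<lambda>s. (f s, y)) has_derivative (\<lambda>d. (f' d, 0))) (at s)"
    by (auto intro!: derivative_eq_intros assms(2))
  from has_derivative_compose[OF this, of \<mu> "D\<mu> (x, y)"] show ?thesis
    using assms D\<mu> by simp
qed

lemma left_field_p: "left_field \<xi> p = \<xi>"
proof -
  have "((\<lambda>y. \<mu> (p, y)) has_derivative (\<lambda>d. D\<mu> (p, p) (0, d))) (at p)"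
    by (rule has_derivative_\<mu>_right[where f="\<lambda>y. y"]) (auto simp: W_p)
  moreover have "((\<lambda>y. \<mu> (p, y)) has_derivative (\<lambda>d. d)) (at p)"
    by (rule has_derivative_transform_within_open[OF has_derivative_ident open_V p_V]) (simp add: \<mu>_p)
  ultimately have "(\<lambda>d. D\<mu> (p, p) (0, d)) = (\<lambda>d. d)" by (rule has_derivative_unique)
  then show ?thesis unfolding left_field_def by metis
qed

lemma open_section: "open {y. (x, y) \<in> W}" "open {x. (x, y) \<in> W}"
proof -
  have "open ((\<lambda>y. (x, y)) -` W)" "open ((\<lambda>x. (x, y)) -` W)"
    by (intro open_vimage open_W continuous_intros)+
  then show "open {y. (x, y) \<in> W}" "open {x. (x, y) \<in> W}" by (simp_all add: vimage_def)
qed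

text \<open>Differentiate associativity, \<open>x (y z) = (x y) z\<close>, in \<open>z\<close> at
  the identity. In the chart this identity holds for \<open>z\<close> near \<open>p\<close>, which
  is all that the derivative sees.\<close>

lemma left_field_invariant:
  assumes "(x, y) \<in> W"
  shows "D\<mu> (x, y) (0, left_field \<xi> y) = left_field \<xi> (\<mu> (x, y))"
proof -
  note V = W_D[OF assms]
  have "((\<lambda>z. \<mu> (y, z)) has_derivative (\<lambda>d. D\<mu> (y, p) (0, d))) (at p)"
    by (rule has_derivative_\<mu>_right[where f="\<lambda>y. y"]) (auto simp: W_p V)
  from has_derivative_\<mu>_right[OF assms this]
  have 1: "((\<lambda>z. \<mu> (x, \<mu> (y, z))) has_derivative (\<lambda>d. D\<mu> (x, y) (0, D\<mu> (y, p) (0, d)))) (at p)"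
    by (simp add: \<mu>_p V)
  have "((\<lambda>z. \<mu> (\<mu> (x, y), z)) has_derivative (\<lambda>d. D\<mu> (\<mu> (x, y), p) (0, d))) (at p)"
    by (rule has_derivative_\<mu>_right[where f="\<lambda>y. y"]) (auto simp: W_p V)
  then have 2: "((\<lambda>z. \<mu> (x, \<mu> (y, z))) has_derivative (\<lambda>d. D\<mu> (\<mu> (x, y), p) (0, d))) (at p)"
    by (rule has_derivative_transform_within_open[OF _ open_Int[OF open_section(1) open_section(1)], of _ _ _ _ y "\<mu> (x, y)"])
      (auto simp: W_p V \<mu>_assoc assms)
  show ?thesis
    using fun_cong[OF has_derivative_unique[OF 1 2], of \<xi>] by (simp add: left_field_def)
qed

end

section \<open>One-parameter subgroups as integral curves, and the adjoint action\<close>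

context lie_chart
begin

text \<open>Differentiate \<open>\<gamma> s = \<gamma> t \<otimes> \<gamma> (s - t)\<close> at
  \<open>s = t\<close>. The neighbourhood \<open>B\<close> lets later arguments confine the curve
  near \<open>p\<close>.\<close>

lemma one_parameter_subgroup_ode:
  assumes \<gamma>: "one_parameter_subgroup G \<gamma>" "((\<phi> \<circ> \<gamma>) has_vector_derivative \<xi>) (at 0)"
    and B: "open B" "p \<in> B"
  obtains \<delta> where "\<delta> > 0" "\<And>t. \<bar>t\<bar> < \<delta> \<Longrightarrow> \<gamma> t \<in> U \<and> (\<phi> \<circ> \<gamma>) t \<in> B \<and>
    ((\<phi> \<circ> \<gamma>) has_vector_derivative left_field \<xi> ((\<phi> \<circ> \<gamma>) t)) (at t)"
proof -
  have hom: "\<gamma> (s + t) = \<gamma> s \<otimes> \<gamma> t" for s t using \<gamma> by (simp add: one_parameter_subgroup_def)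
  then have \<gamma>0: "\<gamma> 0 = \<one>" by (metis UNIV_I add_0 carrier r_cancel_one')
  have "open (U \<inter> \<phi> -` B)"
    by (rule continuous_open_preimage[OF cont_\<phi> open_U B(1)])
  then have "open (\<gamma> -` (U \<inter> \<phi> -` B))"
    using \<gamma>(1) by (intro open_vimage) (simp_all add: one_parameter_subgroup_def)
  moreover have "0 \<in> \<gamma> -` (U \<inter> \<phi> -` B)" using B(2) one_U by (simp add: \<gamma>0 p_def)
  ultimately obtain \<delta> where \<delta>: "\<delta> > 0" "ball 0 \<delta> \<subseteq> \<gamma> -` (U \<inter> \<phi> -` B)"
    by (meson open_contains_ball)
  have in_U: "\<gamma> t \<in> U" "\<phi> (\<gamma> t) \<in> B" if "\<bar>t\<bar> < \<delta>" for t using \<delta>(2) that by auto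
  show thesis
  proof (rule that[OF \<delta>(1)], intro conjI)
    fix t assume t: "\<bar>t\<bar> < \<delta>"
    show "\<gamma> t \<in> U" "(\<phi> \<circ> \<gamma>) t \<in> B" using in_U t by auto
    have "((\<lambda>s. s - t) has_derivative (\<lambda>d. d)) (at t)" by (auto intro!: derivative_eq_intros)
    from has_derivative_compose[OF this, of "\<phi> \<circ> \<gamma>"]
    have "((\<lambda>s. (\<phi> \<circ> \<gamma>) (s - t)) has_derivative (\<lambda>d. d *\<^sub>R \<xi>)) (at t)"
      using \<gamma>(2) by (simp add: has_vector_derivative_def)
    from has_derivative_\<mu>_right[OF W_p(1) this, of "\<phi> (\<gamma> t)"]
    have "((\<lambda>s. \<mu> (\<phi> (\<gamma> t), (\<phi> \<circ> \<gamma>) (s - t))) has_derivative (\<lambda>d. D\<mu> (\<phi> (\<gamma> t), p) (0, d *\<^sub>R \<xi>))) (at t)"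
      using in_U t by (simp add: \<gamma>0 p_def)
    moreover have "D\<mu> (\<phi> (\<gamma> t), p) (0, d *\<^sub>R \<xi>) = d *\<^sub>R left_field \<xi> ((\<phi> \<circ> \<gamma>) t)" for d
      using linear_scale[OF has_derivative_linear[OF D\<mu>[OF W_p(1)]], of "\<phi> (\<gamma> t)" d "(0, \<xi>)"] in_U t
      by (simp add: left_field_def)
    ultimately have "((\<lambda>s. \<mu> (\<phi> (\<gamma> t), (\<phi> \<circ> \<gamma>) (s - t))) has_vector_derivative
        left_field \<xi> ((\<phi> \<circ> \<gamma>) t)) (at t)"
      by (simp add: has_vector_derivative_def)
    then show "((\<phi> \<circ> \<gamma>) has_vector_derivative left_field \<xi> ((\<phi> \<circ> \<gamma>) t)) (at t)"
    proof (rule has_vector_derivative_transform_within_open[OF _ open_ball])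
      show "t \<in> ball t \<delta>" using \<delta> by simp
      fix s assume "s \<in> ball t \<delta>"
      then show "\<mu> (\<phi> (\<gamma> t), (\<phi> \<circ> \<gamma>) (s - t)) = (\<phi> \<circ> \<gamma>) s"
        using in_U[OF t] in_U[of "s - t"] hom[of t "s - t"] by (simp add: \<mu>_def dist_real_def)
    qed
  qed
qed

lemma cball_in_V: obtains r where "r > 0" "cball p r \<subseteq> V"
  using open_V p_V open_contains_cball by meson

lemma left_field_lipschitz:
  assumes "cball p r \<subseteq> V"
  obtains K where "K-lipschitz_on (cball p r) (left_field \<xi>)"
  by (rule smooth_on_imp_lipschitz_on[OF smooth_left_field _ _ assms]) auto

text \<open>Both curves solve the equation of \<open>left_field \<xi>\<close> from \<open>p\<close>,
  so they agree near 0, and the homomorphism law propagates this to all times.\<close>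

lemma one_parameter_subgroup_unique:
  assumes \<gamma>: "one_parameter_subgroup G \<gamma>" "((\<phi> \<circ> \<gamma>) has_vector_derivative \<xi>) (at 0)"
    and \<gamma>': "one_parameter_subgroup G \<gamma>'" "((\<phi> \<circ> \<gamma>') has_vector_derivative \<xi>) (at 0)"
  shows "\<gamma> = \<gamma>'"
proof -
  obtain r where r: "r > 0" "cball p r \<subseteq> V" by (rule cball_in_V)
  then obtain K where K: "K-lipschitz_on (cball p r) (left_field \<xi>)" by (blast elim: left_field_lipschitz)
  have p: "p \<in> ball p r" using r by simp
  obtain d where d: "d > 0" "\<And>t. \<bar>t\<bar> < d \<Longrightarrow> \<gamma> t \<in> U \<and> (\<phi> \<circ> \<gamma>) t \<in> ball p r \<and>
      ((\<phi> \<circ> \<gamma>) has_vector_derivative left_field \<xi> ((\<phi> \<circ> \<gamma>) t)) (at t)"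
    using one_parameter_subgroup_ode[OF \<gamma> open_ball p] by blast
  obtain d' where d': "d' > 0" "\<And>t. \<bar>t\<bar> < d' \<Longrightarrow> \<gamma>' t \<in> U \<and> (\<phi> \<circ> \<gamma>') t \<in> ball p r \<and>
      ((\<phi> \<circ> \<gamma>') has_vector_derivative left_field \<xi> ((\<phi> \<circ> \<gamma>') t)) (at t)"
    using one_parameter_subgroup_ode[OF \<gamma>' open_ball p] by blast
  have hom: "\<gamma> (s + t) = \<gamma> s \<otimes> \<gamma> t" "\<gamma>' (s + t) = \<gamma>' s \<otimes> \<gamma>' t" for s t
    using \<gamma>(1) \<gamma>'(1) by (auto simp: one_parameter_subgroup_def)
  then have 0: "\<gamma> 0 = \<gamma>' 0" by (metis UNIV_I add_0 carrier r_cancel_one')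
  show ?thesis
  proof (rule real_hom_eqI[OF _ _ hom])
    show "min d d' > 0" using d d' by simp
    fix t :: real assume t: "\<bar>t\<bar> < min d d'"
    have "(\<phi> \<circ> \<gamma>) t = (\<phi> \<circ> \<gamma>') t"
      by (rule ode_unique[OF K _ _ _ t]) (use 0 d(2) d'(2) in \<open>auto simp: less_imp_le o_def\<close>)
    then show "\<gamma> t = \<gamma>' t" using inj_\<phi> d(2)[of t] d'(2)[of t] t by (auto simp: inj_on_def)
  qed auto
qed

text \<open>The integral curve \<open>u\<close> of the left invariant field through \<open>p\<close>
  is additive for small times: for fixed \<open>s\<close>, both \<open>\<mu> (u s, u t)\<close> and
  \<open>u (s + t)\<close> solve the same equation in \<open>t\<close> from \<open>u s\<close>. The
  local homomorphism so obtained extends to the line.\<close>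

lemma one_parameter_subgroup_exists:
  obtains \<gamma> where "one_parameter_subgroup G \<gamma>" "((\<phi> \<circ> \<gamma>) has_vector_derivative \<xi>) (at 0)"
proof -
  obtain r where r: "r > 0" "cball p r \<subseteq> V" by (rule cball_in_V)
  then obtain K where K: "K-lipschitz_on (cball p r) (left_field \<xi>)" by (blast elim: left_field_lipschitz)
  obtain h u where h: "h > 0" and u0: "u 0 = p"
    and u: "\<And>t. \<bar>t\<bar> < h \<Longrightarrow> u t \<in> cball p r \<and> (u has_vector_derivative left_field \<xi> (u t)) (at t)"
    using ode_exists[OF K r(1)] by blast
  have uV: "u t \<in> V" if "\<bar>t\<bar> < h" for t using u[OF that] r(2) by auto
  have cont_u: "continuous_on {- h<..<h} u"
    by (intro continuous_at_imp_continuous_on ballI has_vector_derivative_continuous[OF u[THEN conjunct2]])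
      auto
  \<comment> \<open>Pairs whose product is defined in the chart and lies in the ball on which the
    field is Lipschitz, as \<open>ode_unique\<close> requires.\<close>
  define Q where "Q = W \<inter> \<mu> -` ball p r"
  have "open Q" unfolding Q_def
    by (rule continuous_open_preimage[OF smooth_onD(3)[OF smooth_\<mu>] open_W open_ball])
  moreover have "continuous_on ({- h<..<h} \<times> {- h<..<h}) (\<lambda>q. (u (fst q), u (snd q)))"
    by (intro continuous_intros continuous_on_compose2[OF cont_u]) auto
  ultimately have "open (({- h<..<h} \<times> {- h<..<h}) \<inter> (\<lambda>q. (u (fst q), u (snd q))) -` Q)" (is "open ?O")
    by (intro continuous_open_preimage open_Times) auto
  moreover have "(0, 0) \<in> ?O" using h r by (auto simp: u0 Q_def W_p \<mu>_p)
  ultimately obtain e where e: "e > 0" "\<And>s t. dist (s, t) (0, 0) < e \<Longrightarrow> (s, t) \<in> ?O"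
    unfolding open_dist by (metis (no_types, lifting))
  \<comment> \<open>Half of \<open>e\<close> keeps the pair \<open>(s, t)\<close> within distance
    \<open>e\<close> of the origin; half of \<open>h\<close> keeps \<open>s + t\<close> in the
    domain of the solution.\<close>
  define h1 where "h1 = min (e / 2) (h / 2)"
  have h1: "h1 > 0" using e h by (simp add: h1_def)
  have Q: "(u s, u t) \<in> W" "\<mu> (u s, u t) \<in> cball p r" if "\<bar>s\<bar> < h1" "\<bar>t\<bar> < h1" for s t
  proof -
    have "dist (s, t) (0, 0) \<le> \<bar>s\<bar> + \<bar>t\<bar>"
      unfolding dist_Pair_Pair using sqrt_sum_squares_le_sum_abs[of "dist s 0" "dist t 0"] by simp
    also have "\<dots> < e" using that by (simp add: h1_def)
    finally have "(s, t) \<in> ?O" by (rule e(2))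
    then show "(u s, u t) \<in> W" "\<mu> (u s, u t) \<in> cball p r" by (auto simp: Q_def)
  qed
  have add: "\<mu> (u s, u t) = u (s + t)" if s: "\<bar>s\<bar> < h1" and t: "\<bar>t\<bar> < h1" for s t
  proof (rule ode_unique[OF K _ _ _ t])
    have sV: "u s \<in> V" using s h by (intro uV) (auto simp: h1_def)
    show "\<mu> (u s, u 0) = u (s + 0)" using sV by (simp add: u0 \<mu>_p)
    fix t assume t: "\<bar>t\<bar> < h1"
    have th: "\<bar>t\<bar> < h" "\<bar>s + t\<bar> < h" using s t by (auto simp: h1_def)
    have "((\<lambda>t. \<mu> (u s, u t)) has_derivative (\<lambda>d. D\<mu> (u s, u t) (0, d *\<^sub>R left_field \<xi> (u t)))) (at t)"
      using u[OF th(1)] by (intro has_derivative_\<mu>_right[OF Q(1)[OF s t]]) (auto simp: has_vector_derivative_def)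
    moreover have "D\<mu> (u s, u t) (0, d *\<^sub>R left_field \<xi> (u t)) = d *\<^sub>R left_field \<xi> (\<mu> (u s, u t))" for d
      using linear_scale[OF has_derivative_linear[OF D\<mu>[OF Q(1)[OF s t]]], of d "(0, left_field \<xi> (u t))"]
      by (simp add: left_field_invariant[OF Q(1)[OF s t]])
    ultimately show "\<mu> (u s, u t) \<in> cball p r \<and>
        ((\<lambda>t. \<mu> (u s, u t)) has_vector_derivative left_field \<xi> (\<mu> (u s, u t))) (at t)"
      using Q(2)[OF s t] by (simp add: has_vector_derivative_def)
    have "((\<lambda>t. s + t) has_derivative (\<lambda>d. d)) (at t)" by (auto intro!: derivative_eq_intros)
    from has_derivative_compose[OF this, of u] u[OF th(2)]
    show "u (s + t) \<in> cball p r \<and> ((\<lambda>t. u (s + t)) has_vector_derivative left_field \<xi> (u (s + t))) (at t)"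
      by (simp add: has_vector_derivative_def)
  qed
  have hom: "\<psi> (u (s + t)) = \<psi> (u s) \<otimes> \<psi> (u t)" if "\<bar>s\<bar> < h1" "\<bar>t\<bar> < h1" for s t
    using add[OF that] \<psi>_\<mu>[OF Q(1)[OF that]] by simp
  obtain \<gamma> where \<gamma>: "\<And>s t. \<gamma> (s + t) = \<gamma> s \<otimes> \<gamma> t" "\<And>t. \<bar>t\<bar> < h1 \<Longrightarrow> \<gamma> t = \<psi> (u t)"
  proof (rule local_real_hom_extends[of "\<lambda>t. \<psi> (u t)", OF _ h1 hom])
    fix \<Gamma> assume "\<And>s t. \<Gamma> (s + t) = \<Gamma> s \<otimes> \<Gamma> t" "\<And>t. \<bar>t\<bar> < h1 \<Longrightarrow> \<Gamma> t = \<psi> (u t)"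
    then show thesis by (rule that)
  qed simp_all
  have near: "{- h1<..<h1} \<subseteq> {- h<..<h}" using h by (auto simp: h1_def)
  have "continuous_on {- h1<..<h1} (\<lambda>t. \<psi> (u t))"
    using near
    by (intro continuous_on_compose2[OF cont_\<psi> continuous_on_subset[OF cont_u]])
      (auto intro!: uV simp: h1_def)
  then have "continuous_on {- h1<..<h1} \<gamma>"
    using \<gamma>(2) by (subst continuous_on_cong[OF refl, of _ _ "\<lambda>t. \<psi> (u t)"]) auto
  \<comment> \<open>Continuity at 0 spreads to every \<open>t\<close> by translation, through
    \<open>\<gamma> s = \<gamma> t \<otimes> \<gamma> (s - t)\<close>.\<close>
  then have c0: "isCont \<gamma> 0" using h1 by (simp add: continuous_on_eq_continuous_at)
  have "isCont \<gamma> t" for t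
  proof -
    have "isCont (\<lambda>s. \<gamma> (s - t)) t"
      using c0 by (intro isCont_o2[of _ "\<lambda>s. s - t" \<gamma>]) (auto intro!: continuous_intros)
    moreover have "isCont (\<lambda>g. \<gamma> t \<otimes> g) x" for x
    proof -
      have "continuous_on UNIV (\<lambda>g. \<gamma> t \<otimes> g)"
        by (intro continuous_on_mult continuous_on_const continuous_on_id)
      then show ?thesis by (simp add: continuous_on_eq_continuous_at)
    qed
    ultimately have "isCont (\<lambda>s. \<gamma> t \<otimes> \<gamma> (s - t)) t" by (rule isCont_o2)
    then show ?thesis by (simp flip: \<gamma>(1))
  qed
  then have "one_parameter_subgroup G \<gamma>"
    using \<gamma>(1) by (simp add: one_parameter_subgroup_def continuous_at_imp_continuous_on)
  moreover have "((\<phi> \<circ> \<gamma>) has_vector_derivative \<xi>) (at 0)"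
  proof (rule has_vector_derivative_transform_within_open[where f=u and S="{- h1<..<h1}"])
    show "(u has_vector_derivative \<xi>) (at 0)" using u[of 0] h by (simp add: u0 left_field_p)
    show "u t = (\<phi> \<circ> \<gamma>) t" if "t \<in> {- h1<..<h1}" for t
      using \<gamma>(2)[of t] that uV[of t] near by (auto simp: abs_less_iff)
  qed (use h1 in auto)
  ultimately show thesis by (rule that)
qed

text \<open>The curve \<open>s \<mapsto> \<gamma> (t * s)\<close> is the one-parameter subgroup with
  velocity \<open>t *\<^sub>R \<xi>\<close>; uniqueness resolves the definite description in
  \<open>lie_exp\<close>.\<close>

lemma lie_exp_scaleR:
  assumes "one_parameter_subgroup G \<gamma>" "((\<phi> \<circ> \<gamma>) has_vector_derivative \<xi>) (at 0)"
  shows "lie_exp G (U, \<phi>) (t *\<^sub>R \<xi>) = \<gamma> t"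
proof -
  let ?P = "\<lambda>\<gamma>'. one_parameter_subgroup G \<gamma>' \<and> ((snd (U, \<phi>) \<circ> \<gamma>') has_vector_derivative t *\<^sub>R \<xi>) (at 0)"
  have "continuous_on UNIV (\<lambda>s. \<gamma> (t * s))"
    by (rule continuous_on_compose2[of UNIV \<gamma>])
      (use assms(1) in \<open>auto simp: one_parameter_subgroup_def intro!: continuous_intros\<close>)
  then have "one_parameter_subgroup G (\<lambda>s. \<gamma> (t * s))"
    using assms(1) by (simp add: one_parameter_subgroup_def distrib_left)
  moreover have "((\<lambda>s. t * s) has_derivative (\<lambda>d. t * d)) (at 0)" by (auto intro!: derivative_eq_intros)
  from has_derivative_compose[OF this, of "\<phi> \<circ> \<gamma>"] assms(2)
  have "((\<phi> \<circ> (\<lambda>s. \<gamma> (t * s))) has_vector_derivative t *\<^sub>R \<xi>) (at 0)"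
    by (simp add: has_vector_derivative_def o_def mult.commute)
  ultimately have P: "?P (\<lambda>s. \<gamma> (t * s))" by simp
  have "(THE \<gamma>'. ?P \<gamma>') = (\<lambda>s. \<gamma> (t * s))"
  proof (rule the_equality)
    show "?P (\<lambda>s. \<gamma> (t * s))" by (rule P)
    show "\<gamma>' = (\<lambda>s. \<gamma> (t * s))" if "?P \<gamma>'" for \<gamma>'
      using that P by (auto intro!: one_parameter_subgroup_unique)
  qed
  then show ?thesis by (simp add: lie_exp_def)
qed

text \<open>The derivative of \<open>x \<mapsto> u\<^sup>-\<^sup>1 (x u)\<close> at the identity. Bracketed this way, only products lying
  in the chart domain occur.\<close>

definition chart_Ad :: "'g \<Rightarrow> 'g \<Rightarrow> 'g" where
  "chart_Ad u \<eta> = D\<mu> (\<iota> u, u) (0, D\<mu> (p, u) (\<eta>, 0))"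

lemma N_D: "u \<in> N \<Longrightarrow> u \<in> V" "u \<in> N \<Longrightarrow> (\<iota> u, u) \<in> W" "u \<in> N \<Longrightarrow> \<psi> (\<iota> u) = inv\<^bsub>G\<^esub> (\<psi> u)"
  by (auto simp: N_def \<iota>_def W_def one_U)

lemma p_N: "p \<in> N"
  by (simp add: N_def one_U)

text \<open>Two applications of the chain rule. For \<open>x\<close> near \<open>p\<close> the
  coordinate expression equals conjugation exactly: only \<open>(x, u) \<in> W\<close> is used,
  since \<open>\<mu>\<close> unfolds to \<open>\<phi>\<close> of the product in any case.\<close>

lemma has_derivative_conjugation:
  assumes u: "u \<in> N"
  shows "((\<lambda>x. \<phi> (inv\<^bsub>G\<^esub> (\<psi> u) \<otimes> \<psi> x \<otimes> \<psi> u)) has_derivative chart_Ad u) (at p)"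
proof -
  note uD = N_D[OF u]
  have 1: "((\<lambda>x. \<mu> (x, u)) has_derivative (\<lambda>d. D\<mu> (p, u) (d, 0))) (at p)"
    by (rule has_derivative_\<mu>_left) (auto simp: W_p uD)
  have "((\<lambda>x. \<mu> (\<iota> u, \<mu> (x, u))) has_derivative (\<lambda>d. D\<mu> (\<iota> u, u) (0, D\<mu> (p, u) (d, 0)))) (at p)"
    by (rule has_derivative_\<mu>_right[OF uD(2) 1]) (simp add: \<mu>_p uD)
  then have "((\<lambda>x. \<mu> (\<iota> u, \<mu> (x, u))) has_derivative chart_Ad u) (at p)"
    by (simp add: chart_Ad_def[abs_def])
  then show ?thesis
  proof (rule has_derivative_transform_within_open[OF _ open_section(2)])
    show "p \<in> {x. (x, u) \<in> W}" using uD by (simp add: W_p)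
    fix x assume x: "x \<in> {x. (x, u) \<in> W}"
    have "\<mu> (\<iota> u, \<mu> (x, u)) = \<phi> (\<psi> (\<iota> u) \<otimes> \<psi> (\<mu> (x, u)))" by (simp add: \<mu>_def)
    then show "\<mu> (\<iota> u, \<mu> (x, u)) = \<phi> (inv\<^bsub>G\<^esub> (\<psi> u) \<otimes> \<psi> x \<otimes> \<psi> u)"
      using x uD by (simp add: \<psi>_\<mu> m_assoc)
  qed
qed

lemma lie_Ad_eq: "u \<in> N \<Longrightarrow> lie_Ad G (U, \<phi>) (\<psi> u) = chart_Ad u"
  using frechet_derivative_at[OF has_derivative_conjugation] by (simp add: lie_Ad_def p_def \<psi>_def)

lemma linear_chart_Ad: "u \<in> N \<Longrightarrow> linear (chart_Ad u)"
  using has_derivative_conjugation has_derivative_linear by blast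

text \<open>The inner derivative is a direction that moves with \<open>u\<close>; expanding it in
  the basis leaves smooth coefficients and fixed directions.\<close>

lemma smooth_chart_Ad: "smooth_on N (\<lambda>u. chart_Ad u \<eta>)"
proof -
  have sub: "smooth_on N (\<lambda>u. u)" by (rule smooth_on_id[OF open_N])
  have 1: "smooth_on N (\<lambda>u. D\<mu> (p, u) (\<eta>, 0))"
    by (rule smooth_on_compose[OF open_N open_W _ smooth_on_Pair[OF open_N smooth_on_const sub] smooth_onD(2)[OF smooth_\<mu>]])
      (auto simp: W_p N_D)
  have 2: "smooth_on N (\<lambda>u. D\<mu> (\<iota> u, u) v)" for v
    by (rule smooth_on_compose[OF open_N open_W _ smooth_on_Pair[OF open_N smooth_\<iota> sub] smooth_onD(2)[OF smooth_\<mu>]])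
      (auto simp: N_D)
  have "smooth_on N (\<lambda>u. \<Sum>i\<in>Basis. (D\<mu> (p, u) (\<eta>, 0) \<bullet> i) *\<^sub>R D\<mu> (\<iota> u, u) (0, i))"
    by (intro smooth_on_sum open_N smooth_on_bounded_bilinear[OF _ bounded_bilinear_scaleR] 2
        smooth_on_bounded_linear[OF _ bounded_linear_inner_left] 1)
  then show ?thesis
  proof (rule smooth_on_cong[OF open_N])
    fix u assume u: "u \<in> N"
    have "linear (\<lambda>w. D\<mu> (\<iota> u, u) (0, w))"
      using linear_compose[OF _ has_derivative_linear[OF D\<mu>[OF N_D(2)[OF u]]], of "Pair 0"]
      by (simp add: o_def linear_iff)
    from linear_basis_expansion[OF this, of "D\<mu> (p, u) (\<eta>, 0)"]
    show "(\<Sum>i\<in>Basis. (D\<mu> (p, u) (\<eta>, 0) \<bullet> i) *\<^sub>R D\<mu> (\<iota> u, u) (0, i)) = chart_Ad u \<eta>"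
      by (simp add: chart_Ad_def)
  qed
qed

text \<open>The bracket without the exponential map: the derivative of \<open>Ad\<close> at the
  identity, linear in \<open>\<xi>\<close> by construction. \<open>lie_bracket_eq\<close> identifies
  the two.\<close>

definition ad :: "'g \<Rightarrow> 'g \<Rightarrow> 'g" where
  "ad \<xi> \<eta> = frechet_derivative (\<lambda>u. chart_Ad u \<eta>) (at p) \<xi>"

lemma ad: "((\<lambda>u. chart_Ad u \<eta>) has_derivative (\<lambda>\<xi>. ad \<xi> \<eta>)) (at p)"
  unfolding ad_def by (rule smooth_onD(1)[OF smooth_chart_Ad p_N])

lemma
  assumes \<gamma>: "one_parameter_subgroup G \<gamma>" "((\<phi> \<circ> \<gamma>) has_vector_derivative \<xi>) (at 0)"
  shows lie_Ad_has_vector_derivative: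
      "((\<lambda>t. lie_Ad G (U, \<phi>) (\<gamma> t) \<eta>) has_vector_derivative ad \<xi> \<eta>) (at 0)"
    and lie_Ad_fixes_generator: "\<exists>\<delta>>0. \<forall>t. \<bar>t\<bar> < \<delta> \<longrightarrow> lie_Ad G (U, \<phi>) (\<gamma> t) \<xi> = \<xi>"
proof -
  have hom: "\<gamma> (s + t) = \<gamma> s \<otimes> \<gamma> t" for s t using \<gamma> by (simp add: one_parameter_subgroup_def)
  then have \<gamma>0: "\<gamma> 0 = \<one>" by (metis UNIV_I add_0 carrier r_cancel_one')
  obtain \<delta> where \<delta>: "\<delta> > 0" "\<And>t. \<bar>t\<bar> < \<delta> \<Longrightarrow> \<gamma> t \<in> U \<and> \<phi> (\<gamma> t) \<in> N"
    using one_parameter_subgroup_ode[OF \<gamma> open_N p_N] by (metis comp_apply)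
  have Ad: "lie_Ad G (U, \<phi>) (\<gamma> t) = chart_Ad (\<phi> (\<gamma> t))" if "\<bar>t\<bar> < \<delta>" for t
    using lie_Ad_eq[of "\<phi> (\<gamma> t)"] \<delta>(2)[OF that] by simp
  have d0: "((\<phi> \<circ> \<gamma>) has_derivative (\<lambda>d. d *\<^sub>R \<xi>)) (at 0)"
    using \<gamma>(2) by (simp add: has_vector_derivative_def)
  have p: "(\<phi> \<circ> \<gamma>) 0 = p" by (simp add: \<gamma>0 p_def)
  have "((\<lambda>t. chart_Ad (\<phi> (\<gamma> t)) \<eta>) has_derivative (\<lambda>d. ad (d *\<^sub>R \<xi>) \<eta>)) (at 0)"
    using has_derivative_compose[OF d0, of "\<lambda>u. chart_Ad u \<eta>" "\<lambda>\<xi>. ad \<xi> \<eta>"] ad[of \<eta>]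
    unfolding p by (simp add: o_def)
  moreover have "ad (d *\<^sub>R \<xi>) \<eta> = d *\<^sub>R ad \<xi> \<eta>" for d
    using linear_scale[OF has_derivative_linear[OF ad]] by blast
  ultimately have "((\<lambda>t. chart_Ad (\<phi> (\<gamma> t)) \<eta>) has_vector_derivative ad \<xi> \<eta>) (at 0)"
    by (simp add: has_vector_derivative_def)
  then show "((\<lambda>t. lie_Ad G (U, \<phi>) (\<gamma> t) \<eta>) has_vector_derivative ad \<xi> \<eta>) (at 0)"
    by (rule has_vector_derivative_transform_within_open[where S="{- \<delta><..<\<delta>}"]) (use \<delta>(1) Ad in auto)
  have "lie_Ad G (U, \<phi>) (\<gamma> t) \<xi> = \<xi>" if t: "\<bar>t\<bar> < \<delta>" for t
  proof -
    let ?c = "\<lambda>x. \<phi> (inv\<^bsub>G\<^esub> (\<gamma> t) \<otimes> \<psi> x \<otimes> \<gamma> t)"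
    have "(?c has_derivative chart_Ad (\<phi> (\<gamma> t))) (at ((\<phi> \<circ> \<gamma>) 0))"
      using has_derivative_conjugation[of "\<phi> (\<gamma> t)"] \<delta>(2)[OF t] p by simp
    from has_derivative_compose[OF d0 this]
    have "((\<lambda>s. ?c ((\<phi> \<circ> \<gamma>) s)) has_derivative (\<lambda>d. chart_Ad (\<phi> (\<gamma> t)) (d *\<^sub>R \<xi>))) (at 0)" .
    then have "((\<phi> \<circ> \<gamma>) has_derivative (\<lambda>d. chart_Ad (\<phi> (\<gamma> t)) (d *\<^sub>R \<xi>))) (at 0)"
    proof (rule has_derivative_transform_within_open[OF _ open_greaterThanLessThan[of "- \<delta>" \<delta>]])
      fix s assume "s \<in> {- \<delta><..<\<delta>}"
      then have "\<gamma> s \<in> U" using \<delta>(2)[of s] by auto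
      \<comment> \<open>Hence conjugation by \<open>\<gamma> t\<close> fixes the curve
        \<open>\<gamma> s\<close>, and comparing velocities at \<open>s = 0\<close> shows that
        \<open>Ad\<close> fixes \<open>\<xi>\<close>.\<close>
      moreover have "\<gamma> s \<otimes> \<gamma> t = \<gamma> t \<otimes> \<gamma> s" by (metis hom add.commute)
      ultimately show "?c ((\<phi> \<circ> \<gamma>) s) = (\<phi> \<circ> \<gamma>) s" by (simp add: m_assoc flip: m_assoc[of "inv\<^bsub>G\<^esub> (\<gamma> t)" "\<gamma> t"])
    qed (use \<delta>(1) in auto)
    from fun_cong[OF has_derivative_unique[OF this d0], of 1] show ?thesis by (simp add: Ad[OF t])
  qed
  then show "\<exists>\<delta>>0. \<forall>t. \<bar>t\<bar> < \<delta> \<longrightarrow> lie_Ad G (U, \<phi>) (\<gamma> t) \<xi> = \<xi>" using \<delta>(1) by blast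
qed

lemma lie_bracket_eq: "lie_bracket G (U, \<phi>) \<xi> \<eta> = ad \<xi> \<eta>"
proof -
  obtain \<gamma> where \<gamma>: "one_parameter_subgroup G \<gamma>" "((\<phi> \<circ> \<gamma>) has_vector_derivative \<xi>) (at 0)"
    by (rule one_parameter_subgroup_exists)
  show ?thesis
    unfolding lie_bracket_def lie_exp_scaleR[OF \<gamma>]
    by (rule vector_derivative_at[OF lie_Ad_has_vector_derivative[OF \<gamma>]])
qed

text \<open>Along the subgroup generated by \<open>\<xi>\<close>, the curve differentiated in the
  bracket is constant near 0.\<close>

lemma lie_bracket_alternating: "lie_bracket G (U, \<phi>) \<xi> \<xi> = 0"
proof -
  obtain \<gamma> where \<gamma>: "one_parameter_subgroup G \<gamma>" "((\<phi> \<circ> \<gamma>) has_vector_derivative \<xi>) (at 0)"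
    by (rule one_parameter_subgroup_exists)
  obtain \<delta> where \<delta>: "\<delta> > 0" "\<And>t. \<bar>t\<bar> < \<delta> \<Longrightarrow> lie_Ad G (U, \<phi>) (\<gamma> t) \<xi> = \<xi>"
    using lie_Ad_fixes_generator[OF \<gamma>] by blast
  have "((\<lambda>t. lie_Ad G (U, \<phi>) (\<gamma> t) \<xi>) has_vector_derivative 0) (at 0)"
    by (rule has_vector_derivative_transform_within_open[OF has_vector_derivative_const, where S="{- \<delta><..<\<delta>}"])
      (use \<delta> in auto)
  then show ?thesis
    unfolding lie_bracket_eq
    using vector_derivative_unique_at lie_Ad_has_vector_derivative[OF \<gamma>] by blast
qed

text \<open>Linearity in the second argument is inherited from \<open>chart_Ad u\<close>, linear for
  all \<open>u\<close> in the open set \<open>N\<close> around \<open>p\<close>, by differentiating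
  in \<open>u\<close>. Boundedness is automatic in finite dimension.\<close>

lemma lie_bracket_bounded_bilinear: "bounded_bilinear (lie_bracket G (U, \<phi>))"
proof -
  have eq: "lie_bracket G (U, \<phi>) = ad" by (intro ext lie_bracket_eq)
  have left: "linear (\<lambda>\<xi>. ad \<xi> \<eta>)" for \<eta>
    using has_derivative_linear[OF ad] .
  have "ad \<xi> (\<eta> + \<zeta>) = ad \<xi> \<eta> + ad \<xi> \<zeta>" for \<xi> \<eta> \<zeta>
  proof -
    have "((\<lambda>u. chart_Ad u (\<eta> + \<zeta>)) has_derivative (\<lambda>\<xi>. ad \<xi> \<eta> + ad \<xi> \<zeta>)) (at p)"
      by (rule has_derivative_transform_within_open[OF has_derivative_add[OF ad ad] open_N p_N])
        (simp add: linear_add[OF linear_chart_Ad])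
    from fun_cong[OF has_derivative_unique[OF ad this]] show ?thesis .
  qed
  moreover have "ad \<xi> (k *\<^sub>R \<eta>) = k *\<^sub>R ad \<xi> \<eta>" for \<xi> \<eta> k
  proof -
    have "((\<lambda>u. chart_Ad u (k *\<^sub>R \<eta>)) has_derivative (\<lambda>\<xi>. k *\<^sub>R ad \<xi> \<eta>)) (at p)"
      by (rule has_derivative_transform_within_open[OF has_derivative_scaleR_right[OF ad] open_N p_N])
        (simp add: linear_scale[OF linear_chart_Ad])
    from fun_cong[OF has_derivative_unique[OF ad this]] show ?thesis .
  qed
  ultimately have "linear (ad \<xi>)" for \<xi> by (intro linearI)
  with left show ?thesis
    unfolding eq bilinear_conv_bounded_bilinear[symmetric] bilinear_def by simp
qed

end

theorem mainTheorem2: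
  fixes G :: "'m::{t2_space, second_countable_topology} monoid"
    and A :: "('m, 'g::euclidean_space) chart set"
    and c :: "('m, 'g) chart"
    and br :: "'g \<Rightarrow> 'g \<Rightarrow> 'g"
    and L :: "'g \<times> 'g \<Rightarrow> real"
    and a b :: real
    and \<xi>2 \<xi>3 :: "real \<Rightarrow> 'g"
  assumes "lie_group G A"
    and "c \<in> A" and "\<one>\<^bsub>G\<^esub> \<in> fst c"
    and "br = lie_bracket G c"
    and "smooth_on UNIV L"
    and "a < b"
    and "smooth_curve a b \<xi>2" and "smooth_curve a b \<xi>3"
  shows "euler_poincare_extremal (semidirect_bracket br) L a b (\<lambda>t. (\<xi>2 t, \<xi>3 t)) \<longleftrightarrow>
    (\<forall>t\<in>{a..b}.
       ((\<lambda>s. partial_fst L (\<xi>2 s, \<xi>3 s)) has_vector_derivative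
          ad_star br (\<xi>2 t) (partial_fst L (\<xi>2 t, \<xi>3 t)) +
          ad_star br (\<xi>3 t) (partial_snd L (\<xi>2 t, \<xi>3 t))) (at t within {a..b}) \<and>
       ((\<lambda>s. partial_snd L (\<xi>2 s, \<xi>3 s)) has_vector_derivative
          ad_star br (\<xi>2 t) (partial_snd L (\<xi>2 t, \<xi>3 t))) (at t within {a..b}))"
proof -
  obtain U \<phi> where c: "c = (U, \<phi>)" by fastforce
  \<comment> \<open>Only bilinearity and the alternating law of the bracket are taken from the
    group; the variational argument does the rest.\<close>
  interpret lie_chart G A U \<phi>
    using assms(1-3) unfolding c by (simp add: lie_chart_def lie_chart_axioms_def lie_group_def)
  show ?thesis
    unfolding assms(4) c
    by (rule euler_poincare_semidirect[OF lie_bracket_bounded_bilinear lie_bracket_alternating assms(5-8)])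
qed

end
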